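(* Jones' subgroup $\overrightarrow F$ of R. Thompson's group $F$ (the set of all reduced diagrams $\Delta$ in $F$ whose Thompson graph $T(\Delta)$ is bipartite) coincides with its commensurator in $F$.
   Context: The commensurator of a subgroup $H$ of a group $G$ is the set of all $g\in G$ such that $H\cap gHg^{-1}$ has finite index in both $H$ and $gHg^{-1}$. $F$ is the group of all piecewise-linear increasing homeomorphisms of $[0,1]$ with all slopes powers of $2$ and all break points of the derivative dyadic fractions; products are composed from left to right. Diagrams: the cell $\pi$ is the plane directed graph whose top path is one edge and whose bottom path consists of two edges, with the same initial and terminal vertices (all edges are directed left to right). Diagrams over $\langle x\mid x=x^2\rangle$ are the plane graphs (up to isotopy) obtained from the single edge $\mathbf 1$ and from $\pi$ by addition $\Delta_1+\Delta_2$ (identify the terminal vertex of $\Delta_1$ with the initial vertex of $\Delta_2$), multiplication $\Delta_1\circ\Delta_2$ (identify the bottom path of $\Delta_1$ with the top path of $\Delta_2$ when they have the same length), and inversion (reflection in a horizontal line). A diagram $\Delta$ has an initial vertex $\iota(\Delta)$ and a terminal vertex $\tau(\Delta)$; the other vertices are called inner. A dipole is a subdiagram $\pi\circ\pi^{-1}$ or $\pi^{-1}\circ\pi$; it is eliminated by removing its two cells and identifying its top and bottom paths. A diagram is reduced if it has no dipoles; each diagram is equivalent via dipole moves to a unique reduced diagram. "Diagrams in $F$" are those whose top path and bottom path are single edges; reduced such diagrams, with product = reduced form of $\Delta_1\circ\Delta_2$, form a group identified with $F$ as follows. A reduced $\Delta$ is cut by its longest positive path from $\iota(\Delta)$ to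 $\tau(\Delta)$ as $\Delta=\Delta^+\circ\Delta^-$, where $\Delta^+$ consists of cells $\pi$ and $\Delta^-$ of cells $\pi^{-1}$. Assign $[0,1]$ to the top edge of $\Delta^+$ and, for each cell, the left and right halves of the interval of its top edge to its left and right bottom edges; the bottom path of $\Delta^+$ gives a dyadic subdivision of $[0,1]$ (top subdivision). Doing the same with $(\Delta^-)^{-1}$ gives the bottom subdivision. $\Delta$ corresponds to the homeomorphism mapping each segment of the top subdivision linearly onto the corresponding segment of the bottom subdivision. Thompson graph $T(\Delta)$: its vertices are all vertices of $\Delta$ except $\tau(\Delta)$; its edges are, for every inner vertex $v$ of $\Delta$, the top-most incoming edge of $v$ in $\Delta$ (upper edge) and the bottom-most incoming edge of $v$ in $\Delta$ (lower edge), counted as two distinct edges if they coincide. *)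

theory Defs
  imports "HOL-Analysis.Analysis" "HOL-Algebra.Coset" "Graph_Theory.Arc_Walk"
begin

section \<open>Commensurators\<close>

definition commensurator :: "('g, 'm) monoid_scheme \<Rightarrow> 'g set \<Rightarrow> 'g set" where
  "commensurator G H = {g \<in> carrier G.
     let K = (g <#\<^bsub>G\<^esub> H) #>\<^bsub>G\<^esub> (inv\<^bsub>G\<^esub> g) in
       finite (rcosets\<^bsub>G\<lparr>carrier := H\<rparr>\<^esub> (H \<inter> K)) \<and>
       finite (rcosets\<^bsub>G\<lparr>carrier := K\<rparr>\<^esub> (H \<inter> K))}"


section \<open>Thompson's group\<close>

definition dyadic_fractions :: "real set" where
  "dyadic_fractions = {x. \<exists>(m::int) (n::nat). x = of_int m / 2 ^ n}"

text \<open>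
  Maps of the unit interval are represented by functions that are \<^const>\<open>undefined\<close> outside it.
  The set \<open>B\<close> contains all break points of the derivative.
\<close>

definition thompson_map :: "(real \<Rightarrow> real) \<Rightarrow> bool" where
  "thompson_map f \<longleftrightarrow>
     f \<in> extensional {0..1} \<and>
     (\<exists>g. homeomorphism {0..1} {0..1} f g) \<and>
     strict_mono_on {0..1} f \<and>
     (\<exists>B. finite B \<and> B \<subseteq> dyadic_fractions \<and>
        (\<forall>a b. 0 \<le> a \<and> a < b \<and> b \<le> 1 \<and> {a<..<b} \<inter> B = {} \<longrightarrow>
           (\<exists>(k::int) (c::real). \<forall>x\<in>{a..b}. f x = 2 powi k * x + c)))"

text \<open>Products are composed from left to right: \<open>f \<otimes> g\<close> applies \<open>f\<close> first.\<close>

definition thompson_F :: "(real \<Rightarrow> real) monoid" where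
  "thompson_F = \<lparr>carrier = {f. thompson_map f},
     mult = (\<lambda>f g. compose {0..1} g f),
     one = (\<lambda>x\<in>{0..1}. x)\<rparr>"


section \<open>Diagrams over the semigroup presentation \<open>\<langle>x | x = x\<^sup>2\<rangle>\<close>\<close>

text \<open>
  A plane diagram is recorded, up to isotopy, by its edges, its cells (each given by its top and
  bottom path), its top path and its bottom path. The names of edges and vertices are arbitrary.
  Identifying boundary paths of two diagrams then amounts to naming them so that the paths are
  equal and nothing else is shared, and taking unions.
\<close>

datatype edge = Edge (label: nat) (src: nat) (tgt: nat)

type_synonym cell = "edge list \<times> edge list"

record diagram =
  edge_set :: "edge set"
  cell_set :: "cell set"
  top_path :: "edge list"
  bot_path :: "edge list"

definition path_verts :: "edge list \<Rightarrow> nat set" where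
  "path_verts p = src ` set p \<union> tgt ` set p"

definition digraph_of :: "diagram \<Rightarrow> (nat, edge) pre_digraph" where
  "digraph_of D = \<lparr>verts = src ` edge_set D \<union> tgt ` edge_set D, arcs = edge_set D,
     tail = src, head = tgt\<rparr>"

abbreviation diagram_verts :: "diagram \<Rightarrow> nat set" where
  "diagram_verts D \<equiv> verts (digraph_of D)"

definition initial_vertex :: "diagram \<Rightarrow> nat" where
  "initial_vertex D = src (hd (top_path D))"

definition terminal_vertex :: "diagram \<Rightarrow> nat" where
  "terminal_vertex D = tgt (last (top_path D))"

definition inner_verts :: "diagram \<Rightarrow> nat set" where
  "inner_verts D = diagram_verts D - {initial_vertex D, terminal_vertex D}"

definition edge_diagram :: "edge \<Rightarrow> diagram" where
  "edge_diagram e = \<lparr>edge_set = {e}, cell_set = {}, top_path = [e], bot_path = [e]\<rparr>"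

definition pi_diagram :: "edge \<Rightarrow> edge \<Rightarrow> edge \<Rightarrow> diagram" where
  "pi_diagram e f g =
     \<lparr>edge_set = {e, f, g}, cell_set = {([e], [f, g])}, top_path = [e], bot_path = [f, g]\<rparr>"

definition diagram_add :: "diagram \<Rightarrow> diagram \<Rightarrow> diagram" where
  "diagram_add A B = \<lparr>edge_set = edge_set A \<union> edge_set B, cell_set = cell_set A \<union> cell_set B,
     top_path = top_path A @ top_path B, bot_path = bot_path A @ bot_path B\<rparr>"

definition diagram_mult :: "diagram \<Rightarrow> diagram \<Rightarrow> diagram" where
  "diagram_mult A B = \<lparr>edge_set = edge_set A \<union> edge_set B, cell_set = cell_set A \<union> cell_set B,
     top_path = top_path A, bot_path = bot_path B\<rparr>"

definition diagram_inverse :: "diagram \<Rightarrow> diagram" where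
  "diagram_inverse A = \<lparr>edge_set = edge_set A, cell_set = prod.swap ` cell_set A,
     top_path = bot_path A, bot_path = top_path A\<rparr>"

definition addable :: "diagram \<Rightarrow> diagram \<Rightarrow> bool" where
  "addable A B \<longleftrightarrow> terminal_vertex A = initial_vertex B \<and>
     diagram_verts A \<inter> diagram_verts B = {terminal_vertex A} \<and>
     edge_set A \<inter> edge_set B = {}"

definition multipliable :: "diagram \<Rightarrow> diagram \<Rightarrow> bool" where
  "multipliable A B \<longleftrightarrow> bot_path A = top_path B \<and>
     diagram_verts A \<inter> diagram_verts B = path_verts (bot_path A) \<and>
     edge_set A \<inter> edge_set B = set (bot_path A)"

inductive is_diagram :: "diagram \<Rightarrow> bool" where
  edge: "src e \<noteq> tgt e \<Longrightarrow> is_diagram (edge_diagram e)"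
| pi: "\<lbrakk>src f = src e; tgt f = src g; tgt g = tgt e; distinct [src e, tgt f, tgt e]\<rbrakk>
    \<Longrightarrow> is_diagram (pi_diagram e f g)"
| add: "\<lbrakk>is_diagram A; is_diagram B; addable A B\<rbrakk> \<Longrightarrow> is_diagram (diagram_add A B)"
| mult: "\<lbrakk>is_diagram A; is_diagram B; multipliable A B\<rbrakk> \<Longrightarrow> is_diagram (diagram_mult A B)"
| inverse: "is_diagram A \<Longrightarrow> is_diagram (diagram_inverse A)"

definition is_pi_cell :: "cell \<Rightarrow> bool" where
  "is_pi_cell c \<longleftrightarrow> length (fst c) = 1 \<and> length (snd c) = 2"

definition is_pi_inverse_cell :: "cell \<Rightarrow> bool" where
  "is_pi_inverse_cell c \<longleftrightarrow> length (fst c) = 2 \<and> length (snd c) = 1"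

definition is_dipole :: "cell \<Rightarrow> cell \<Rightarrow> bool" where
  "is_dipole c d \<longleftrightarrow> snd c = fst d \<and>
     (is_pi_cell c \<and> is_pi_inverse_cell d \<or> is_pi_inverse_cell c \<and> is_pi_cell d)"

definition reduced :: "diagram \<Rightarrow> bool" where
  "reduced D \<longleftrightarrow> \<not> (\<exists>c\<in>cell_set D. \<exists>d\<in>cell_set D. is_dipole c d)"

definition diagram_in_F :: "diagram \<Rightarrow> bool" where
  "diagram_in_F D \<longleftrightarrow> is_diagram D \<and> length (top_path D) = 1 \<and> length (bot_path D) = 1"


section \<open>The homeomorphism represented by a diagram\<close>

definition longest_positive_path :: "diagram \<Rightarrow> edge list \<Rightarrow> bool" where
  "longest_positive_path D p \<longleftrightarrow>
     pre_digraph.awalk (digraph_of D) (initial_vertex D) p (terminal_vertex D) \<and>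
     (\<forall>q. pre_digraph.awalk (digraph_of D) (initial_vertex D) q (terminal_vertex D) \<longrightarrow>
        length q \<le> length p)"

text \<open>
  For a diagram \<open>P\<close> all of whose cells are \<open>\<pi>\<close>, \<open>assigned P e a b\<close> says that the interval
  \<open>[a, b]\<close> is assigned to the edge \<open>e\<close>.
\<close>

inductive assigned :: "diagram \<Rightarrow> edge \<Rightarrow> real \<Rightarrow> real \<Rightarrow> bool" for P where
  top: "top_path P = [e] \<Longrightarrow> assigned P e 0 1"
| left: "\<lbrakk>([e], [f, g]) \<in> cell_set P; assigned P e a b\<rbrakk> \<Longrightarrow> assigned P f a ((a + b) / 2)"
| right: "\<lbrakk>([e], [f, g]) \<in> cell_set P; assigned P e a b\<rbrakk> \<Longrightarrow> assigned P g ((a + b) / 2) b"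

definition maps_linearly :: "(real \<Rightarrow> real) \<Rightarrow> real \<Rightarrow> real \<Rightarrow> real \<Rightarrow> real \<Rightarrow> bool" where
  "maps_linearly f a b c d \<longleftrightarrow> (\<forall>t\<in>{0..1}. f (a + t * (b - a)) = c + t * (d - c))"

definition represents :: "diagram \<Rightarrow> (real \<Rightarrow> real) \<Rightarrow> bool" where
  "represents D f \<longleftrightarrow> (\<exists>P N.
     is_diagram P \<and> is_diagram N \<and> multipliable P N \<and> D = diagram_mult P N \<and>
     longest_positive_path D (bot_path P) \<and>
     (\<forall>c\<in>cell_set P. is_pi_cell c) \<and> (\<forall>c\<in>cell_set N. is_pi_inverse_cell c) \<and>
     (\<forall>e\<in>set (bot_path P). \<exists>a b c d.
        assigned P e a b \<and> assigned (diagram_inverse N) e c d \<and> maps_linearly f a b c d))"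


section \<open>The Thompson graph and Jones' subgroup\<close>

definition incoming :: "diagram \<Rightarrow> nat \<Rightarrow> edge set" where
  "incoming D v = {e \<in> edge_set D. tgt e = v}"

text \<open>
  In the plane, an edge is above another one if one can get from the former to the latter by
  crossing cells from their top path to their bottom path. The edges coming into an inner vertex
  are linearly ordered by this relation, since neighbouring ones bound a common cell.
\<close>

definition above :: "diagram \<Rightarrow> (edge \<times> edge) set" where
  "above D = {(e, e'). \<exists>(p, q)\<in>cell_set D. e \<in> set p \<and> e' \<in> set q}\<^sup>+"

definition topmost_incoming :: "diagram \<Rightarrow> nat \<Rightarrow> edge \<Rightarrow> bool" where
  "topmost_incoming D v e \<longleftrightarrow>
     e \<in> incoming D v \<and> (\<forall>e'\<in>incoming D v - {e}. (e, e') \<in> above D)"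

definition bottommost_incoming :: "diagram \<Rightarrow> nat \<Rightarrow> edge \<Rightarrow> bool" where
  "bottommost_incoming D v e \<longleftrightarrow>
     e \<in> incoming D v \<and> (\<forall>e'\<in>incoming D v - {e}. (e', e) \<in> above D)"

text \<open>
  The disjoint sum keeps the upper and the lower edge of a vertex apart when they come from the
  same edge of the diagram. The direction of the arcs is irrelevant for bipartiteness.
\<close>

definition thompson_graph :: "diagram \<Rightarrow> (nat, edge + edge) pre_digraph" where
  "thompson_graph D = \<lparr>verts = diagram_verts D - {terminal_vertex D},
     arcs = {e. \<exists>v\<in>inner_verts D. topmost_incoming D v e} <+>
            {e. \<exists>v\<in>inner_verts D. bottommost_incoming D v e},
     tail = case_sum src src, head = case_sum tgt tgt\<rparr>"

definition bipartite :: "('v, 'a) pre_digraph \<Rightarrow> bool" where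
  "bipartite G \<longleftrightarrow> (\<exists>U W. verts G = U \<union> W \<and> U \<inter> W = {} \<and>
     (\<forall>e\<in>arcs G. tail G e \<in> U \<and> head G e \<in> W \<or> tail G e \<in> W \<and> head G e \<in> U))"

definition jones_subgroup :: "(real \<Rightarrow> real) set" where
  "jones_subgroup = {f \<in> carrier thompson_F. \<exists>D. diagram_in_F D \<and> reduced D \<and>
     represents D f \<and> bipartite (thompson_graph D)}"

end

theory Submission
  imports Defs
begin

text \<open>
  Jones' subgroup turns out to be the stabilizer of a set of points: it consists of the elements of
  \<open>F\<close> that preserve the parity of the binary digit sum of every dyadic fraction. In the tree of
  dyadic intervals, the vertex that splits \<open>[m / 2^k, (m + 1) / 2^k]\<close> has the left half of that
  interval as its topmost incoming edge, and this edge starts at \<open>m / 2^k\<close>. Going from \<open>m / 2^k\<close> to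
  the midpoint appends a digit \<open>1\<close>, hence changes the parity of the digit sum. So the upper edges of
  the Thompson graph admit, once the initial vertex is called even, only one 2-colouring: the parity
  of the digit sum of the points of the top subdivision. The lower edges likewise force the parity in
  the bottom subdivision. The graph is bipartite if and only if both colourings agree, that is, if the
  homeomorphism \<open>f\<close> preserves parity at the points of the subdivision; between them \<open>f\<close> keeps all
  further digits, so then it preserves parity everywhere. Lemmas \<open>jones_preserves_parity\<close> and
  \<open>jones_if_preserves_parity\<close> are the two directions; the latter draws the diagram of a smallest pair
  of trees that represents \<open>f\<close>, smallest in order that the diagram be reduced.

  Now let \<open>H\<close> be this stabilizer and let \<open>g\<close> be in its commensurator. The subgroup \<open>H\<close> contains a map
  \<open>h\<close> with \<open>h x < x\<close> on \<open>(0, 1)\<close>. By finiteness of the index some positive power \<open>h^r\<close> is conjugate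
  under \<open>g\<close> to an element \<open>h'\<close> of \<open>H\<close>, so that \<open>g (h^(r n) x) = h'^n (g x)\<close> for all \<open>n\<close>. Given
  \<open>x < 1\<close>, the point \<open>h^(r n) x\<close> comes as close to \<open>0\<close> as desired, and near \<open>0\<close> the map \<open>g\<close>
  multiplies by a power of \<open>2\<close>, which only shifts digits. Hence the following points all have the same
  parity: \<open>x\<close>, \<open>h^(r n) x\<close>, \<open>g (h^(r n) x) = h'^n (g x)\<close> and \<open>g x\<close>. So \<open>g\<close> is in \<open>H\<close>.
\<close>

section \<open>Parity of binary digit sums\<close>

text \<open>
  The binary digit sum of \<open>n\<close> is odd.
\<close>

fun thue_morse :: "nat \<Rightarrow> bool" where
  "thue_morse n = (if n = 0 then False else odd n \<noteq> thue_morse (n div 2))"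

declare thue_morse.simps [simp del]

lemma thue_morse_0 [simp]: "\<not> thue_morse 0"
  by (simp add: thue_morse.simps)

lemma thue_morse_double [simp]: "thue_morse (2 * n) = thue_morse n"
  by (subst thue_morse.simps) auto

lemma thue_morse_Suc_double [simp]: "thue_morse (Suc (2 * n)) = (\<not> thue_morse n)"
  by (subst thue_morse.simps) auto

text \<open>
  Appending the digits of \<open>r\<close>, padded to length \<open>j\<close>, to those of \<open>m\<close> adds the digit sums.
\<close>

lemma thue_morse_append: "r < 2 ^ j \<Longrightarrow> thue_morse (m * 2 ^ j + r) = (thue_morse m \<noteq> thue_morse r)"
proof (induction j arbitrary: r)
  case (Suc j)
  have IH: "thue_morse (m * 2 ^ j + r div 2) = (thue_morse m \<noteq> thue_morse (r div 2))"
    using Suc.prems by (intro Suc.IH) auto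
  show ?case
  proof (cases "even r")
    case True
    then have "m * 2 ^ Suc j + r = 2 * (m * 2 ^ j + r div 2)" "r = 2 * (r div 2)" by auto
    then show ?thesis using IH thue_morse_double by metis
  next
    case False
    then have "m * 2 ^ Suc j + r = Suc (2 * (m * 2 ^ j + r div 2))" "r = Suc (2 * (r div 2))" by auto
    then show ?thesis using IH thue_morse_Suc_double by metis
  qed
qed simp

text \<open>
  The numerator \<open>m\<close> over a power of 2 is not unique, but replacing \<open>m / 2^n\<close> by \<open>2 m / 2^(n + 1)\<close>
  only appends a zero, so the condition on \<open>m\<close> is one on the point itself.
\<close>

definition odd_dyadics :: "real set" where
  "odd_dyadics = {real m / 2 ^ n | m n. m < 2 ^ n \<and> thue_morse m}"

lemma odd_dyadics_iff:
  assumes "m < 2 ^ n" shows "real m / 2 ^ n \<in> odd_dyadics \<longleftrightarrow> thue_morse m"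
proof
  assume "real m / 2 ^ n \<in> odd_dyadics"
  then obtain m' n' where *: "thue_morse m'" "real m / 2 ^ n = real m' / 2 ^ n'"
    by (auto simp: odd_dyadics_def)
  then have "real (m * 2 ^ n' + 0) = real (m' * 2 ^ n + 0)" by (simp add: field_simps)
  then have "m * 2 ^ n' + 0 = m' * 2 ^ n + 0" by (simp only: of_nat_eq_iff)
  then show "thue_morse m" using * thue_morse_append[of 0 n' m] thue_morse_append[of 0 n m'] by simp
qed (use assms in \<open>auto simp: odd_dyadics_def\<close>)

lemma dyadic_add: "x \<in> dyadic_fractions \<Longrightarrow> y \<in> dyadic_fractions \<Longrightarrow> x + y \<in> dyadic_fractions"
proof -
  assume "x \<in> dyadic_fractions" "y \<in> dyadic_fractions"
  then obtain a m b n where xy: "x = of_int a / 2 ^ m" "y = of_int b / 2 ^ n"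
    by (auto simp: dyadic_fractions_def)
  have "x + y = of_int (a * 2 ^ n + b * 2 ^ m) / 2 ^ (m + n)"
    unfolding xy by (simp add: field_simps power_add)
  then show ?thesis unfolding dyadic_fractions_def by blast
qed

lemma dyadic_mult: "x \<in> dyadic_fractions \<Longrightarrow> y \<in> dyadic_fractions \<Longrightarrow> x * y \<in> dyadic_fractions"
proof -
  assume "x \<in> dyadic_fractions" "y \<in> dyadic_fractions"
  then obtain a m b n where xy: "x = of_int a / 2 ^ m" "y = of_int b / 2 ^ n"
    by (auto simp: dyadic_fractions_def)
  have "x * y = of_int (a * b) / 2 ^ (m + n)"
    unfolding xy by (simp add: field_simps power_add)
  then show ?thesis unfolding dyadic_fractions_def by blast
qed

lemma dyadic_int: "of_int a \<in> dyadic_fractions"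
  unfolding dyadic_fractions_def by (intro CollectI exI[of _ a] exI[of _ 0]) simp

lemma dyadic_nat: "real a \<in> dyadic_fractions"
  using dyadic_int[of "int a"] by simp

lemma dyadic_diff: "x \<in> dyadic_fractions \<Longrightarrow> y \<in> dyadic_fractions \<Longrightarrow> x - y \<in> dyadic_fractions"
  using dyadic_add[of x "of_int (-1) * y"] dyadic_mult[OF dyadic_int[of "-1"], of y] by simp

lemma dyadic_div: "x \<in> dyadic_fractions \<Longrightarrow> x / 2 ^ n \<in> dyadic_fractions"
proof -
  have "1 / 2 ^ n \<in> dyadic_fractions"
    unfolding dyadic_fractions_def by (intro CollectI exI[of _ 1] exI[of _ n]) simp
  then show "x \<in> dyadic_fractions \<Longrightarrow> ?thesis" using dyadic_mult[of x "1 / 2 ^ n"] by simp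
qed

lemma dyadic_pow: "2 ^ n \<in> dyadic_fractions"
  using dyadic_nat[of "2 ^ n"] by simp

lemma dyadic_powi: "2 powi k \<in> dyadic_fractions"
proof (cases "k \<ge> 0")
  case True
  then show ?thesis using dyadic_pow[of "nat k"] by (simp add: power_int_def)
next
  case False
  then show ?thesis using dyadic_div[OF dyadic_nat[of 1], of "nat (- k)"]
    by (simp add: power_int_def field_simps)
qed

lemma dyadic_append_iff: "(real m + u) / 2 ^ k \<in> dyadic_fractions \<longleftrightarrow> u \<in> dyadic_fractions"
proof
  assume "(real m + u) / 2 ^ k \<in> dyadic_fractions"
  from dyadic_diff[OF dyadic_mult[OF this dyadic_pow[of k]] dyadic_nat[of m]]
  show "u \<in> dyadic_fractions" by simp
qed (intro dyadic_div dyadic_add dyadic_nat)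

lemma odd_dyadics_dyadic: "odd_dyadics \<subseteq> dyadic_fractions"
  by (auto simp: odd_dyadics_def intro!: dyadic_div dyadic_nat)

lemma odd_dyadics_append:
  assumes "m < 2 ^ k" "0 \<le> u" "u < 1"
  shows "(real m + u) / 2 ^ k \<in> odd_dyadics \<longleftrightarrow> u \<in> dyadic_fractions \<and> (thue_morse m \<noteq> (u \<in> odd_dyadics))"
proof (cases "u \<in> dyadic_fractions")
  case False
  then show ?thesis using dyadic_append_iff odd_dyadics_dyadic by blast
next
  case True
  then obtain a :: int and j where a: "u = of_int a / 2 ^ j" by (auto simp: dyadic_fractions_def)
  have "of_int a = u * 2 ^ j" using a by simp
  then have "of_int a \<ge> (0::real)" "of_int a < (of_int (2 ^ j) :: real)" using assms by auto
  then have aj: "0 \<le> a" "a < 2 ^ j" by (simp_all only: of_int_0_le_iff of_int_less_iff)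
  define r where "r = nat a"
  have r: "u = real r / 2 ^ j" "r < 2 ^ j" using a aj by (auto simp: r_def nat_less_iff)
  have eq: "(real m + u) / 2 ^ k = real (m * 2 ^ j + r) / 2 ^ (k + j)"
    by (simp add: r(1) field_simps power_add)
  have "m * 2 ^ j + r < (m + 1) * 2 ^ j" using r(2) by simp
  also have "\<dots> \<le> 2 ^ k * 2 ^ j" using assms(1) by (intro mult_right_mono) auto
  finally have "m * 2 ^ j + r < 2 ^ (k + j)" by (simp add: power_add)
  then have "(real m + u) / 2 ^ k \<in> odd_dyadics \<longleftrightarrow> thue_morse (m * 2 ^ j + r)"
    unfolding eq by (rule odd_dyadics_iff)
  then show ?thesis using True r odd_dyadics_iff[OF r(2)] thue_morse_append[OF r(2)] by simp
qed

text \<open>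
  Throughout, a pair \<open>(k, m)\<close> stands for the dyadic interval \<open>[m / 2^k, (m + 1) / 2^k]\<close>.
\<close>

definition interval_map :: "(real \<Rightarrow> real) \<Rightarrow> nat \<times> nat \<Rightarrow> nat \<times> nat \<Rightarrow> bool" where
  "interval_map f I J \<longleftrightarrow>
     (\<forall>u\<in>{0..1}. f ((real (snd I) + u) / 2 ^ fst I) = (real (snd J) + u) / 2 ^ fst J)"

text \<open>
  Both points have the same digits after the position where the intervals are split off, so only
  the parities of \<open>m\<close> and \<open>m'\<close> matter.
\<close>

lemma interval_map_parity:
  assumes "interval_map f (k, m) (l, m')" "m < 2 ^ k" "m' < 2 ^ l" "thue_morse m = thue_morse m'" "0
      \<le> u" "u < 1"
  shows "f ((real m + u) / 2 ^ k) \<in> odd_dyadics \<longleftrightarrow> (real m + u) / 2 ^ k \<in> odd_dyadics"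
proof -
  have "f ((real m + u) / 2 ^ k) = (real m' + u) / 2 ^ l"
    using assms(1,5,6) by (auto simp: interval_map_def)
  then show ?thesis using odd_dyadics_append assms by auto
qed

lemma grid_interval:
  assumes "0 \<le> x" "x < 1"
  obtains i u where "i < 2 ^ N" "0 \<le> u" "u < 1" "x = (real i + u) / 2 ^ N"
proof
  define i where "i = nat \<lfloor>x * 2 ^ N\<rfloor>"
  have 0: "x * 2 ^ N < 2 ^ N" "0 \<le> x * 2 ^ N" using assms by auto
  then have i: "real i = of_int \<lfloor>x * 2 ^ N\<rfloor>" by (simp add: i_def)
  then have "real i < 2 ^ N" using 0 by linarith
  then show "i < 2 ^ N" by simp
  show "0 \<le> x * 2 ^ N - real i" "x * 2 ^ N - real i < 1" using i by linarith+
  show "x = (real i + (x * 2 ^ N - real i)) / 2 ^ N" by simp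
qed

section \<open>Thompson's group\<close>

lemma thompson_mapD:
  assumes "thompson_map f"
  shows "f \<in> extensional {0..1}" "strict_mono_on {0..1} f" "f ` {0..1} = {0..1}"
    "f 0 = 0" "f 1 = 1"
proof -
  show 1: "f \<in> extensional {0..1}" "strict_mono_on {0..1} f" "f ` {0..1} = {0..1}"
    using assms by (auto simp: thompson_map_def homeomorphism_def)
  have mem: "f x \<in> {0..1}" if "x \<in> {0..1}" for x using 1(3) that by blast
  obtain x where x: "x \<in> {0..1}" "f x = 0" using 1(3)
      by (metis atLeastAtMost_iff imageE order_refl zero_le_one)
  have "f 0 \<le> f x" using x strict_mono_onD[OF 1(2), of 0 x] by (cases "x = 0") auto
  then show "f 0 = 0" using x mem[of 0] by auto
  obtain y where y: "y \<in> {0..1}" "f y = 1" using 1(3)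
      by (metis atLeastAtMost_iff imageE order_refl zero_le_one)
  have "f y \<le> f 1" using y strict_mono_onD[OF 1(2), of y 1] by (cases "y = 1") auto
  then show "f 1 = 1" using y mem[of 1] by auto
qed

text \<open>
  A power of 2 serves as common denominator of the finitely many break points, so no grid interval
  has a break point inside.
\<close>

lemma thompson_linear:
  assumes "thompson_map f"
  shows "\<exists>n. \<forall>i<2 ^ n. \<exists>(k::int) (c::real). \<forall>x\<in>{real i / 2 ^ n..(real i + 1) / 2 ^ n}.
      f x = 2 powi k * x + c"
proof -
  obtain B where B: "finite B" "B \<subseteq> dyadic_fractions"
     and lin: "\<And>a b. 0 \<le> a \<Longrightarrow> a < b \<Longrightarrow> b \<le> 1 \<Longrightarrow> {a<..<b} \<inter> B = {} \<Longrightarrow>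
           (\<exists>(k::int) (c::real). \<forall>x\<in>{a..b}. f x = 2 powi k * x + c)"
    using assms by (auto simp: thompson_map_def)
  have "\<exists>n. \<forall>b\<in>B. \<exists>p::int. b = of_int p / 2 ^ n"
    using B
  proof (induction rule: finite_induct)
    case (insert b B)
    then obtain n where n: "\<forall>b\<in>B. \<exists>p::int. b = of_int p / 2 ^ n" by auto
    obtain q :: int and m where b: "b = of_int q / 2 ^ m" using insert(4)
        by (auto simp: dyadic_fractions_def)
    have "\<exists>p::int. b' = of_int p / 2 ^ (n + m)" if b': "b' \<in> insert b B" for b'
    proof (cases "b' = b")
      case True
      then have "b' = of_int (q * 2 ^ n) / 2 ^ (n + m)" using b by (simp add: power_add)
      then show ?thesis by blast
    next
      case False
      then obtain p :: int where "b' = of_int p / 2 ^ n" using n b' by blast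
      then have "b' = of_int (p * 2 ^ m) / 2 ^ (n + m)" by (simp add: power_add)
      then show ?thesis by blast
    qed
    then show ?case by blast
  qed simp
  then obtain n where n: "\<forall>b\<in>B. \<exists>p::int. b = of_int p / 2 ^ n" by blast
  have "\<exists>(k::int) (c::real). \<forall>x\<in>{real i / 2 ^ n..(real i + 1) / 2 ^ n}. f x = 2 powi k * x + c"
      if i: "i < 2 ^ n" for i
  proof (rule lin)
    show "(real i + 1) / 2 ^ n \<le> 1"
    proof -
      have "real (i + 1) \<le> real (2 ^ n)" using i by (simp only: of_nat_le_iff)
      then show ?thesis by (simp add: field_simps)
    qed
    show "{real i / 2 ^ n<..<(real i + 1) / 2 ^ n} \<inter> B = {}"
    proof (rule ccontr)
      assume "\<not> ?thesis"
      then obtain b where b: "b \<in> B" "real i / 2 ^ n < b" "b < (real i + 1) / 2 ^ n" by auto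
      then obtain p :: int where "b = of_int p / 2 ^ n" using n by blast
      then have "real i < of_int p" "of_int p < real i + 1" using b
          by (auto simp: divide_less_cancel field_simps)
      then have "of_int (int i) < (of_int p :: real)" "(of_int p :: real) < of_int (int i + 1)" by
          simp_all
      then have "int i < p" "p < int i + 1" by (simp_all only: of_int_less_iff)
      then show False by linarith
    qed
  qed (auto simp: divide_strict_right_mono)
  then show ?thesis by blast
qed

text \<open>
  On a fine enough grid \<open>f\<close> is linear on each interval and maps grid points to dyadic fractions. An
  image interval need not be of the form \<open>(l, m)\<close>, since its left end need not be a multiple of its
  length; but bisecting an interval halves the length of the image while the denominators of the old
  end points stay the same, so this holds for every fine enough grid.
\<close>

lemma thompson_grid:
  assumes "thompson_map f"
  shows "\<exists>N. \<forall>i<2 ^ N. \<exists>J. interval_map f (N, i) J"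
proof -
  note D = thompson_mapD[OF assms]
  obtain n where n: "\<forall>i<2 ^ n. \<exists>(k::int) (c::real). \<forall>x\<in>{real i / 2 ^ n..(real i + 1) / 2 ^ n}. f x =
      2 powi k * x + c"
    using thompson_linear[OF assms] by blast
  have dy: "i \<le> 2 ^ n \<Longrightarrow> f (real i / 2 ^ n) \<in> dyadic_fractions" for i
  proof (induction i)
    case 0
    then show ?case using D dyadic_nat[of 0] by simp
  next
    case (Suc i)
    then obtain k :: int and c :: real
      where kc: "\<forall>x\<in>{real i / 2 ^ n..(real i + 1) / 2 ^ n}. f x = 2 powi k * x + c"
      using n by (meson Suc_le_lessD)
    have "f (real i / 2 ^ n) = 2 powi k * (real i / 2 ^ n) + c"
      "f (real (Suc i) / 2 ^ n) = 2 powi k * ((real i + 1) / 2 ^ n) + c"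
      using kc by (auto simp: add.commute divide_right_mono)
    then have "f (real (Suc i) / 2 ^ n) = f (real i / 2 ^ n) + 2 powi k * (1 / 2 ^ n)"
      by (simp add: field_simps)
    moreover have "1 / 2 ^ n \<in> dyadic_fractions" using dyadic_div[OF dyadic_nat[of 1]] by simp
    moreover have "f (real i / 2 ^ n) \<in> dyadic_fractions" using Suc by simp
    ultimately show ?case by (simp only:) (intro dyadic_add dyadic_mult dyadic_powi)
  qed
  have ev: "\<forall>\<^sub>F M in sequentially. \<forall>r<2 ^ M. \<exists>J. interval_map f (n + M, i * 2 ^ M + r) J"
      if i: "i < 2 ^ n" for i
  proof -
    obtain k :: int and c :: real
      where kc: "\<forall>x\<in>{real i / 2 ^ n..(real i + 1) / 2 ^ n}. f x = 2 powi k * x + c"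
      using n i by blast
    obtain p' :: int and q where p': "f (real i / 2 ^ n) = of_int p' / 2 ^ q"
      using dy[of i] i by (auto simp: dyadic_fractions_def)
    have "real i / 2 ^ n \<in> {0..1}" using i by (simp add: field_simps)
    then have "f (real i / 2 ^ n) \<ge> 0" using D(3) by fastforce
    then have "0 \<le> (of_int p' / 2 ^ q) * (2 ^ q :: real)" using p' by (intro mult_nonneg_nonneg) auto
    then have "p' \<ge> 0" by simp
    define p where "p = nat p'"
    have p: "f (real i / 2 ^ n) = real p / 2 ^ q" using p' \<open>p' \<ge> 0\<close> by (simp add: p_def)
    have "\<exists>J. interval_map f (n + M, i * 2 ^ M + r) J" if M: "M \<ge> nat (k + int q)"
        and r: "r < 2 ^ M" for M r
    proof -
      \<comment> \<open>slope \<open>2^k\<close> turns an interval of length \<open>2^-(n + M)\<close> into one of length \<open>2^-l\<close>\<close>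
      define l where "l = nat (int (n + M) - k)"
      have l: "int l = int (n + M) - k" "l \<ge> q" using M by (auto simp: l_def)
      have pw: "2 powi k * 2 ^ l = (2 ^ (n + M) :: real)"
      proof -
        have "(2::real) powi k * 2 powi (int l) = 2 powi (k + int l)"
          by (simp add: power_int_add)
        also have "k + int l = int (n + M)" using l by simp
        finally show ?thesis by (simp only: power_int_of_nat)
      qed
      have "f ((real (i * 2 ^ M + r) + u) / 2 ^ (n + M)) = (real (p * 2 ^ (l - q) + r) + u) / 2 ^ l"
        if u: "u \<in> {0..1}" for u
      proof -
        let ?x = "(real (i * 2 ^ M + r) + u) / 2 ^ (n + M)"
        have x: "?x = real i / 2 ^ n + (real r + u) / 2 ^ (n + M)" by (simp add: power_add field_simps)
        have "real r + 1 \<le> 2 ^ M" using r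
            by (metis Suc_leI of_nat_Suc of_nat_le_iff of_nat_numeral of_nat_power add.commute)
        then have "(real r + u) / 2 ^ (n + M) \<le> 2 ^ M / 2 ^ (n + M)" using u
            by (intro divide_right_mono) auto
        also have "\<dots> = 1 / 2 ^ n" by (simp add: power_add)
        finally have "?x \<in> {real i / 2 ^ n..(real i + 1) / 2 ^ n}" using u unfolding x
            by (simp add: add_divide_distrib)
        then have "f ?x = 2 powi k * ?x + c" using kc by blast
        also have "\<dots> = f (real i / 2 ^ n) + 2 powi k * ((real r + u) / 2 ^ (n + M))"
        proof -
          have "f (real i / 2 ^ n) = 2 powi k * (real i / 2 ^ n) + c" using kc
              by (auto simp: divide_right_mono)
          then show ?thesis unfolding x by (simp add: algebra_simps)
        qed
        also have "2 powi k * ((real r + u) / 2 ^ (n + M)) = (real r + u) / 2 ^ l"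
          by (simp add: pw[symmetric] del: power_add)
        also have "f (real i / 2 ^ n) = real (p * 2 ^ (l - q)) / 2 ^ l"
        proof -
          have "(2::real) ^ l = 2 ^ (l - q) * 2 ^ q" using l(2) by (simp add: power_add[symmetric])
          then show ?thesis using p by simp
        qed
        finally show ?thesis by (simp add: add_divide_distrib)
      qed
      then have "interval_map f (n + M, i * 2 ^ M + r) (l, p * 2 ^ (l - q) + r)"
          by (simp add: interval_map_def)
      then show ?thesis by blast
    qed
    then have "\<forall>M\<ge>nat (k + int q). \<forall>r<2 ^ M. \<exists>J. interval_map f (n + M, i * 2 ^ M + r) J" by blast
    then show ?thesis unfolding eventually_sequentially by blast
  qed
  have "\<forall>\<^sub>F M in sequentially. \<forall>i\<in>{..<2 ^ n}. \<forall>r<2 ^ M. \<exists>J. interval_map f (n + M, i * 2 ^ M + r) J"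
    using ev by (intro eventually_ball_finite) auto
  then obtain M where M: "\<forall>i<2 ^ n. \<forall>r<2 ^ M. \<exists>J. interval_map f (n + M, i * 2 ^ M + r) J"
    unfolding eventually_sequentially by (metis lessThan_iff order_refl)
  have "\<exists>J. interval_map f (n + M, j) J" if j: "j < 2 ^ (n + M)" for j
  proof -
    have "j div 2 ^ M < 2 ^ n" using j by (simp add: power_add less_mult_imp_div_less)
    moreover have "j mod 2 ^ M < 2 ^ M" by simp
    ultimately have "\<exists>J. interval_map f (n + M, j div 2 ^ M * 2 ^ M + j mod 2 ^ M) J" using M by blast
    then show ?thesis unfolding div_mult_mod_eq .
  qed
  then show ?thesis by blast
qed

lemma thompson_dyadic_iff:
  assumes "thompson_map f" "x \<in> {0..1}"
  shows "f x \<in> dyadic_fractions \<longleftrightarrow> x \<in> dyadic_fractions"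
proof (cases "x = 1")
  case True
  then show ?thesis using thompson_mapD[OF assms(1)] by simp
next
  case False
  obtain N where N: "\<forall>i<2 ^ N. \<exists>J. interval_map f (N, i) J" using thompson_grid[OF assms(1)] by blast
  obtain i u where iu: "i < 2 ^ N" "0 \<le> u" "u < 1" "x = (real i + u) / 2 ^ N"
    using grid_interval[of x N] assms(2) False by auto
  obtain l m where "interval_map f (N, i) (l, m)" using N iu by fastforce
  then have "f x = (real m + u) / 2 ^ l" using iu by (simp add: interval_map_def)
  then show ?thesis using iu dyadic_append_iff by simp
qed

lemma thompson_mapI:
  assumes "f \<in> extensional {0..1}" "homeomorphism {0..1} {0..1} f g" "strict_mono_on {0..1} f"
    "finite B" "B \<subseteq> dyadic_fractions"
    "\<And>a b. 0 \<le> a \<Longrightarrow> a < b \<Longrightarrow> b \<le> 1 \<Longrightarrow> {a<..<b} \<inter> B = {} \<Longrightarrow>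
           (\<exists>(k::int) (c::real). \<forall>x\<in>{a..b}. f x = 2 powi k * x + c)"
  shows "thompson_map f"
  unfolding thompson_map_def
proof (intro conjI exI[of _ g] exI[of _ B] allI impI assms(1-5))
  fix a b :: real
  assume "0 \<le> a \<and> a < b \<and> b \<le> 1 \<and> {a<..<b} \<inter> B = {}"
  then show "\<exists>(k::int) (c::real). \<forall>x\<in>{a..b}. f x = 2 powi k * x + c"
    by (elim conjE) (rule assms(6))
qed

lemma thompson_id: "thompson_map (\<lambda>x\<in>{0..1}. x)"
proof (rule thompson_mapI[where B = "{}" and g = "\<lambda>x. x"])
  show "homeomorphism {0..1} {0..1} (\<lambda>x\<in>{0..1}. x) (\<lambda>x. x)"
    by (rule homeomorphism_cong[OF homeomorphism_ident]) auto
  fix a b :: real assume "0 \<le> a" "b \<le> 1"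
  then show "\<exists>k c. \<forall>x\<in>{a..b}. (\<lambda>x\<in>{0..1}. x) x = 2 powi k * x + c"
    by (intro exI[of _ 0]) auto
qed (auto simp: strict_mono_on_def)

lemma strict_mono_on_less_iff:
  fixes f :: "real \<Rightarrow> real"
  assumes "strict_mono_on A f" "x \<in> A" "y \<in> A"
  shows "f x < f y \<longleftrightarrow> x < y"
  using assms by (metis linorder_neqE_linordered_idom order_less_asym strict_mono_onD)

lemma thompson_compose:
  assumes f: "thompson_map f" and g: "thompson_map g"
  shows "thompson_map (compose {0..1} g f)"
proof -
  note F = thompson_mapD[OF f] and G = thompson_mapD[OF g]
  obtain f' where f': "homeomorphism {0..1} {0..1} f f'" using f by (auto simp: thompson_map_def)
  obtain g' where g': "homeomorphism {0..1} {0..1} g g'" using g by (auto simp: thompson_map_def)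
  obtain B where B: "finite B" "B \<subseteq> dyadic_fractions"
     and Blin: "\<And>a b. 0 \<le> a \<Longrightarrow> a < b \<Longrightarrow> b \<le> 1 \<Longrightarrow> {a<..<b} \<inter> B = {} \<Longrightarrow>
           (\<exists>(k::int) (c::real). \<forall>x\<in>{a..b}. f x = 2 powi k * x + c)"
    using f by (auto simp: thompson_map_def)
  obtain C where C: "finite C" "C \<subseteq> dyadic_fractions"
     and Clin: "\<And>a b. 0 \<le> a \<Longrightarrow> a < b \<Longrightarrow> b \<le> 1 \<Longrightarrow> {a<..<b} \<inter> C = {} \<Longrightarrow>
           (\<exists>(k::int) (c::real). \<forall>x\<in>{a..b}. g x = 2 powi k * x + c)"
    using g by (auto simp: thompson_map_def)
  have inj: "inj_on f {0..1}" using F(2) by (rule strict_mono_on_imp_inj_on)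
  have mem: "f x \<in> {0..1}" if "x \<in> {0..1}" for x using F(3) that by blast
  define C' where "C' = {x \<in> {0..1}. f x \<in> C}"
  show ?thesis
  proof (rule thompson_mapI[where B = "B \<union> C'" and g = "f' \<circ> g'"])
    show "compose {0..1} g f \<in> extensional {0..1}" by simp
    show "homeomorphism {0..1} {0..1} (compose {0..1} g f) (f' \<circ> g')"
      by (rule homeomorphism_cong[OF homeomorphism_compose[OF f' g']]) (auto simp: compose_def)
    show "strict_mono_on {0..1} (compose {0..1} g f)"
      using F(2) G(2) mem by (auto simp: strict_mono_on_def compose_def)
    have "finite (f -` C \<inter> {0..1})" using C(1) inj by (rule finite_vimage_IntI)
    then have "finite C'" by (rule rev_finite_subset) (auto simp: C'_def)
    then show "finite (B \<union> C')" using B by simp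
    show "B \<union> C' \<subseteq> dyadic_fractions"
      using B C thompson_dyadic_iff[OF f] by (auto simp: C'_def)
    fix a b :: real assume ab: "0 \<le> a" "a < b" "b \<le> 1" "{a<..<b} \<inter> (B \<union> C') = {}"
    then have "{a<..<b} \<inter> B = {}" by blast
    then obtain k :: int and c :: real where kc: "\<forall>x\<in>{a..b}. f x = 2 powi k * x + c"
      using Blin ab by blast
    have fab: "0 \<le> f a" "f a < f b" "f b \<le> 1"
      using mem[of a] mem[of b] ab F(2) by (auto simp: strict_mono_on_def)
    have "{f a<..<f b} \<inter> C = {}"
    proof (rule ccontr)
      assume "\<not> ?thesis"
      then obtain y where y: "f a < y" "y < f b" "y \<in> C" by auto
      then have "y \<in> f ` {0..1}" using F(3) fab by auto
      then obtain x where x: "x \<in> {0..1}" "y = f x" by blast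
      then have "a < x" "x < b" using y ab strict_mono_on_less_iff[OF F(2)] by auto
      then have "x \<in> {a<..<b} \<inter> C'" using x y by (auto simp: C'_def)
      then show False using ab(4) by blast
    qed
    then obtain k' :: int and c' :: real where kc': "\<forall>x\<in>{f a..f b}. g x = 2 powi k' * x + c'"
      using Clin fab by blast
    have "compose {0..1} g f x = 2 powi (k' + k) * x + (2 powi k' * c + c')" if x: "x \<in> {a..b}" for x
    proof -
      have "f x \<in> {f a..f b}" using x ab F(2) by (auto simp: strict_mono_on_def less_eq_real_def)
      then have "g (f x) = 2 powi k' * (2 powi k * x + c) + c'" using kc kc' x by simp
      then show ?thesis using x ab by (simp add: compose_def power_int_add algebra_simps)
    qed
    then show "\<exists>k c. \<forall>x\<in>{a..b}. compose {0..1} g f x = 2 powi k * x + c" by blast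
  qed
qed

lemma thompson_inverse:
  assumes f: "thompson_map f"
  shows "\<exists>g. thompson_map g \<and> (\<forall>x\<in>{0..1}. g (f x) = x)"
proof -
  note F = thompson_mapD[OF f]
  obtain f' where f': "homeomorphism {0..1} {0..1} f f'" using f by (auto simp: thompson_map_def)
  obtain B where B: "finite B" "B \<subseteq> dyadic_fractions"
     and Blin: "\<And>a b. 0 \<le> a \<Longrightarrow> a < b \<Longrightarrow> b \<le> 1 \<Longrightarrow> {a<..<b} \<inter> B = {} \<Longrightarrow>
           (\<exists>(k::int) (c::real). \<forall>x\<in>{a..b}. f x = 2 powi k * x + c)"
    using f by (auto simp: thompson_map_def)
  have left: "f' (f x) = x" and right: "f (f' x) = x" and mem: "f x \<in> {0..1}" and mem': "f' x \<in> {0..1}"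
    if "x \<in> {0..1}" for x
    using f' that by (auto simp: homeomorphism_def)
  have less: "f' x < f' y" if "x < y" "x \<in> {0..1}" "y \<in> {0..1}" for x y
    using strict_mono_on_less_iff[OF F(2) mem' mem', of x y] that right by auto
  have "thompson_map (restrict f' {0..1})"
  proof (rule thompson_mapI[where B = "f ` (B \<inter> {0..1})" and g = f])
    show "homeomorphism {0..1} {0..1} (restrict f' {0..1}) f"
      by (rule homeomorphism_cong[OF homeomorphism_symD[OF f']]) auto
    show "strict_mono_on {0..1} (restrict f' {0..1})"
      using less by (auto simp: strict_mono_on_def)
    show "f ` (B \<inter> {0..1}) \<subseteq> dyadic_fractions"
      using B thompson_dyadic_iff[OF f] by auto
    fix a b :: real assume ab: "0 \<le> a" "a < b" "b \<le> 1" "{a<..<b} \<inter> f ` (B \<inter> {0..1}) = {}"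
    have fab: "0 \<le> f' a" "f' a < f' b" "f' b \<le> 1"
      using mem'[of a] mem'[of b] ab less by auto
    have "{f' a<..<f' b} \<inter> B = {}"
    proof (rule ccontr)
      assume "\<not> ?thesis"
      then obtain y where y: "f' a < y" "y < f' b" "y \<in> B" by auto
      then have y01: "y \<in> {0..1}" using fab by auto
      then have "f (f' a) < f y" "f y < f (f' b)" using y fab F(2) by (auto simp: strict_mono_on_def)
      then have "f y \<in> {a<..<b} \<inter> f ` (B \<inter> {0..1})" using y y01 right ab by auto
      then show False using ab(4) by blast
    qed
    then obtain k :: int and c :: real where kc: "\<forall>x\<in>{f' a..f' b}. f x = 2 powi k * x + c"
      using Blin fab by blast
    have "restrict f' {0..1} x = 2 powi (-k) * x + (- (2 powi (-k)) * c)" if x: "x \<in> {a..b}" for x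
    proof -
      have x01: "x \<in> {0..1}" using x ab by auto
      have "f' x \<in> {f' a..f' b}" using x ab less[of a x] less[of x b] by (auto simp: less_eq_real_def)
      then have "x = 2 powi k * f' x + c" using kc right[OF x01] by metis
      then have "2 powi (-k) * x = 2 powi (-k) * (2 powi k * f' x + c)" by simp
      then have "2 powi (-k) * x - 2 powi (-k) * c = (2 powi (-k) * 2 powi k) * f' x"
          by (simp only: algebra_simps)
      also have "(2 powi (-k) * 2 powi k :: real) = 1" by (simp add: power_int_minus)
      finally show ?thesis using x01 by simp
    qed
    then show "\<exists>k c. \<forall>x\<in>{a..b}. restrict f' {0..1} x = 2 powi k * x + c" by blast
  qed (use B in auto)
  then show ?thesis using left mem by (intro exI[of _ "restrict f' {0..1}"]) auto
qed

lemma thompson_F_simps [simp]: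
  "f \<in> carrier thompson_F \<longleftrightarrow> thompson_map f"
  "f \<otimes>\<^bsub>thompson_F\<^esub> g = compose {0..1} g f"
  "\<one>\<^bsub>thompson_F\<^esub> = (\<lambda>x\<in>{0..1}. x)"
  by (simp_all add: thompson_F_def)

lemma thompson_range: "thompson_map f \<Longrightarrow> x \<in> {0..1} \<Longrightarrow> f x \<in> {0..1}"
  using thompson_mapD(3) by blast

lemma group_F: "group thompson_F"
proof (rule groupI)
  fix f g h assume fgh: "f \<in> carrier thompson_F" "g \<in> carrier thompson_F" "h \<in> carrier thompson_F"
  then show "f \<otimes>\<^bsub>thompson_F\<^esub> g \<otimes>\<^bsub>thompson_F\<^esub> h = f \<otimes>\<^bsub>thompson_F\<^esub> (g \<otimes>\<^bsub>thompson_F\<^esub> h)"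
    using thompson_range[of f] by (auto simp: compose_def restrict_def fun_eq_iff)
next
  fix f assume f: "f \<in> carrier thompson_F"
  then show "\<one>\<^bsub>thompson_F\<^esub> \<otimes>\<^bsub>thompson_F\<^esub> f = f"
    using thompson_mapD(1)[of f] by (auto simp: compose_def fun_eq_iff extensional_def)
  obtain g where g: "thompson_map g" "\<forall>x\<in>{0..1}. g (f x) = x" using thompson_inverse f by auto
  have right: "f (g y) = y" if "y \<in> {0..1}" for y
  proof -
    have "y \<in> f ` {0..1}" using that thompson_mapD(3)[of f] f by simp
    then obtain x where "x \<in> {0..1}" "y = f x" by blast
    then show ?thesis using g by simp
  qed
  then have "g \<otimes>\<^bsub>thompson_F\<^esub> f = \<one>\<^bsub>thompson_F\<^esub>" by (auto simp: compose_def fun_eq_iff)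
  then show "\<exists>g\<in>carrier thompson_F. g \<otimes>\<^bsub>thompson_F\<^esub> f = \<one>\<^bsub>thompson_F\<^esub>" using g by auto
qed (auto simp: thompson_compose thompson_id)

section \<open>Dyadic subdivisions as binary trees\<close>

datatype tree = Leaf | Node tree tree

fun width :: "tree \<Rightarrow> nat" where
  "width Leaf = 1"
| "width (Node l r) = width l + width r"

text \<open>
  The subdivision of the dyadic interval \<open>I\<close> described by the tree, from left to right.
\<close>

fun leaf_intervals :: "tree \<Rightarrow> nat \<times> nat \<Rightarrow> (nat \<times> nat) list" where
  "leaf_intervals Leaf I = [I]"
| "leaf_intervals (Node l r) I =
     leaf_intervals l (Suc (fst I), 2 * snd I) @ leaf_intervals r (Suc (fst I), Suc (2 * snd I))"

lemma width_pos [simp]: "0 < width t"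
  by (induction t) auto

lemma length_leaf_intervals [simp]: "length (leaf_intervals t I) = width t"
  by (induction t arbitrary: I) auto

lemma leaf_intervals_nonempty [simp]: "leaf_intervals t I \<noteq> []"
  using length_leaf_intervals[of t I] width_pos[of t] by (metis length_greater_0_conv)

text \<open>
  The first interval of the subdivision has the same left end, so its numerator is \<open>snd I\<close> with zeros
  appended.
\<close>

lemma thue_morse_hd_leaf_intervals: "thue_morse (snd (hd (leaf_intervals t I))) = thue_morse (snd I)"
  by (induction t arbitrary: I) auto

lemma leaf_intervals_unit: "J \<in> set (leaf_intervals t I) \<Longrightarrow> snd I < 2 ^ fst I \<Longrightarrow> snd J < 2 ^ fst J"
proof (induction t arbitrary: I)
  case (Node l r)
  then show ?case using Node.IH[of "(Suc (fst I), 2 * snd I)"] Node.IH(2)[of "(Suc (fst I), Suc (2 *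
      snd I))"]
    by auto
qed auto

definition left_end :: "nat \<times> nat \<Rightarrow> real" where "left_end I = real (snd I) / 2 ^ fst I"
definition right_end :: "nat \<times> nat \<Rightarrow> real" where "right_end I = (real (snd I) + 1) / 2 ^ fst I"

lemma left_end_less_right_end: "left_end I < right_end I"
  by (simp add: left_end_def right_end_def divide_strict_right_mono)

lemma interval_map_ends: "interval_map f I J \<Longrightarrow> f (left_end I) = left_end J \<and>
    f (right_end I) = right_end J"
proof -
  assume *: "interval_map f I J"
  have "(0::real) \<in> {0..1}" "(1::real) \<in> {0..1}" by simp_all
  from this[THEN bspec[OF *[unfolded interval_map_def]]] show ?thesis
      by (simp add: left_end_def right_end_def)
qed

lemma interval_map_iff_maps_linearly: "interval_map f I J \<longleftrightarrow> maps_linearly f (left_end I) (right_end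
    I) (left_end J) (right_end J)"
proof -
  have "left_end I + t * (right_end I - left_end I) = (real (snd I) + t) / 2 ^ fst I" for I t
    by (simp add: left_end_def right_end_def field_simps)
  then show ?thesis by (simp add: interval_map_def maps_linearly_def)
qed

lemma half_ends:
  "left_end (Suc k, 2 * m) = left_end (k, m)" "right_end (Suc k, 2 * m) = (left_end (k, m) +
      right_end (k, m)) / 2"
  "left_end (Suc k, Suc (2 * m)) = (left_end (k, m) + right_end (k, m)) / 2" "right_end (Suc k, Suc
      (2 * m)) = right_end (k, m)"
  by (simp_all add: left_end_def right_end_def field_simps)

text \<open>
  The listed dyadic intervals cover \<open>[a, b]\<close> from left to right without overlap.
\<close>

fun tiles :: "real \<Rightarrow> (nat \<times> nat) list \<Rightarrow> real \<Rightarrow> bool" where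
  "tiles a [] b \<longleftrightarrow> a = b"
| "tiles a (I # L) b \<longleftrightarrow> left_end I = a \<and> tiles (right_end I) L b"

lemma tiles_append: "tiles a (X @ Y) c \<longleftrightarrow> (\<exists>b. tiles a X b \<and> tiles b Y c)"
  by (induction X arbitrary: a) auto

lemma tiles_leaf_intervals: "tiles (left_end I) (leaf_intervals t I) (right_end I)"
proof (induction t arbitrary: I)
  case (Node l r)
  obtain k m where I: "I = (k, m)" by (cases I)
  show ?case using Node.IH[of "(Suc k, 2 * m)"] Node.IH(2)[of "(Suc k, Suc (2 * m))"]
    unfolding I by (auto simp: tiles_append half_ends)
qed simp

lemma tiles_image:
  "tiles a X b \<Longrightarrow> list_all2 (interval_map f) X L \<Longrightarrow> tiles (f a) L (f b)"
proof (induction X arbitrary: a L)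
  case (Cons I X)
  then obtain J L' where L: "L = J # L'" "interval_map f I J" "list_all2 (interval_map f) X L'"
    by (auto simp: list_all2_Cons1)
  then show ?case using interval_map_ends[OF L(2)] Cons.IH[OF _ L(3), of "right_end I"] Cons.prems
      by auto
qed simp

lemma tiles_mono: "tiles a L b \<Longrightarrow> a \<le> b \<and> (L \<noteq> [] \<longrightarrow> a < b)"
proof (induction L arbitrary: a)
  case (Cons I L)
  then show ?case using left_end_less_right_end[of I] by fastforce
qed simp

lemma tiles_bounds: "tiles a L b \<Longrightarrow> J \<in> set L \<Longrightarrow> a \<le> left_end J \<and> right_end J \<le> b"
proof (induction L arbitrary: a)
  case (Cons I L)
  then show ?case using left_end_less_right_end[of I] tiles_mono[of "right_end I" L b] by fastforce
qed simp

lemma tiles_split: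
  assumes "tiles a L b" "a \<le> c" "c \<le> b" "\<forall>J\<in>set L. \<not> (left_end J < c \<and> c < right_end J)"
  shows "\<exists>X Y. L = X @ Y \<and> tiles a X c \<and> tiles c Y b"
  using assms
proof (induction L arbitrary: a)
  case (Cons J L)
  show ?case
  proof (cases "c = a")
    case True
    then show ?thesis using Cons.prems by (intro exI[of _ "[]"] exI[of _ "J # L"]) auto
  next
    case False
    then have "right_end J \<le> c" using Cons.prems by auto
    then obtain X Y where "L = X @ Y" "tiles (right_end J) X c" "tiles c Y b"
      using Cons.IH[of "right_end J"] Cons.prems by auto
    then show ?thesis using Cons.prems by (intro exI[of _ "J # X"] exI[of _ Y]) auto
  qed
qed simp

text \<open>
  Two dyadic intervals are nested or do not overlap; hence a dyadic subinterval of \<open>I\<close> that has the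
  midpoint of \<open>I\<close> in its interior is \<open>I\<close> itself.
\<close>

lemma dyadic_interval_eqI:
  assumes "left_end I \<le> left_end J" "right_end J \<le> right_end I" "left_end J < (left_end I +
      right_end I) / 2" "(left_end I + right_end I) / 2 < right_end J"
  shows "J = I"
proof -
  obtain k m where I: "I = (k, m)" by (cases I)
  obtain k' m' where J: "J = (k', m')" by (cases J)
  have mid: "(left_end I + right_end I) / 2 = real (2 * m + 1) / 2 ^ Suc k"
      by (simp add: I left_end_def right_end_def field_simps)
  have "1 / 2 ^ k' = right_end J - left_end J"
      by (simp add: J left_end_def right_end_def diff_divide_distrib[symmetric])
  also have "\<dots> \<le> right_end I - left_end I" using assms by simp
  also have "\<dots> = 1 / 2 ^ k" by (simp add: I left_end_def right_end_def diff_divide_distrib[symmetric])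
  finally have "(2::real) ^ k \<le> 2 ^ k'" by (simp add: field_simps)
  then have "k \<le> k'" by simp
  moreover have "\<not> k < k'"
  proof
    assume "k < k'"
    then obtain d where d: "k' = Suc k + d" using less_iff_Suc_add by auto
    have mid': "(left_end I + right_end I) / 2 = real ((2 * m + 1) * 2 ^ d) / 2 ^ k'"
      unfolding mid d by (simp add: power_add field_simps)
    have "real m' < real ((2 * m + 1) * 2 ^ d)" "real ((2 * m + 1) * 2 ^ d) < real (m' + 1)"
      using assms(3,4)[unfolded mid'] unfolding J left_end_def right_end_def fst_conv snd_conv
          divide_less_cancel
      by auto
    then have "m' < (2 * m + 1) * 2 ^ d" "(2 * m + 1) * 2 ^ d < m' + 1"
        by (simp_all only: of_nat_less_iff)
    then show False by linarith
  qed
  ultimately have k: "k' = k" by simp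
  have "real m \<le> real m'" "real (m' + 1) \<le> real (m + 1)"
    using assms(1,2) unfolding I J left_end_def right_end_def k by (auto simp: divide_le_cancel)
  then show ?thesis using I J k by simp
qed

text \<open>
  Unless the tiling is trivial, none of its intervals crosses the midpoint, so that it splits into
  tilings of both halves.
\<close>

lemma tiling_from_tree:
  "tiles (left_end I) L (right_end I) \<Longrightarrow> \<exists>t. leaf_intervals t I = L"
proof (induction "length L" arbitrary: I L rule: less_induct)
  case less
  define c where "c = (left_end I + right_end I) / 2"
  have c: "left_end I < c" "c < right_end I" using left_end_less_right_end[of I] by (auto simp: c_def)
  show ?case
  proof (cases "I \<in> set L")
    case True
    then obtain X Y where L: "L = X @ I # Y" by (meson split_list)
    then have "tiles (left_end I) X (left_end I)" "tiles (right_end I) Y (right_end I)"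
        using less.prems by (auto simp: tiles_append)
    then have "X = []" "Y = []" using tiles_mono by blast+
    then have "L = [I]" using L by simp
    then show ?thesis by (intro exI[of _ Leaf]) simp
  next
    case False
    have "\<forall>J\<in>set L. \<not> (left_end J < c \<and> c < right_end J)"
      using dyadic_interval_eqI tiles_bounds[OF less.prems] False unfolding c_def by metis
    then obtain X Y where XY: "L = X @ Y" "tiles (left_end I) X c" "tiles c Y (right_end I)"
      using tiles_split[OF less.prems less_imp_le[OF c(1)] less_imp_le[OF c(2)]] by blast
    then have "X \<noteq> []" "Y \<noteq> []" using c by auto
    then have len: "length X < length L" "length Y < length L" using XY(1) by auto
    obtain k m where I: "I = (k, m)" by (cases I)
    obtain l where l: "leaf_intervals l (Suc k, 2 * m) = X"
      using less.hyps[OF len(1), of "(Suc k, 2 * m)"] XY(2) I by (auto simp: half_ends c_def)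
    obtain r where r: "leaf_intervals r (Suc k, Suc (2 * m)) = Y"
      using less.hyps[OF len(2), of "(Suc k, Suc (2 * m))"] XY(3) I by (auto simp: half_ends c_def)
    show ?thesis using l r XY(1) I by (intro exI[of _ "Node l r"]) simp
  qed
qed

fun full_tree :: "nat \<Rightarrow> tree" where
  "full_tree 0 = Leaf"
| "full_tree (Suc d) = Node (full_tree d) (full_tree d)"

lemma leaf_intervals_full_tree:
  "J \<in> set (leaf_intervals (full_tree d) I) \<Longrightarrow> fst J = fst I + d"
  by (induction d arbitrary: I) auto

definition tree_pair :: "(real \<Rightarrow> real) \<Rightarrow> tree \<Rightarrow> tree \<Rightarrow> bool" where
  "tree_pair f t s \<longleftrightarrow> list_all2 (interval_map f) (leaf_intervals t (0, 0)) (leaf_intervals s (0, 0))"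

text \<open>
  The grid intervals are the leaves of a full tree, and their images form a tiling of \<open>[0, 1]\<close>, which
  comes from a tree as well.
\<close>

lemma tree_pair_exists:
  assumes "thompson_map f"
  shows "\<exists>t s. tree_pair f t s"
proof -
  obtain N where N: "\<forall>i<2 ^ N. \<exists>J. interval_map f (N, i) J" using thompson_grid[OF assms] by blast
  let ?X = "leaf_intervals (full_tree N) (0, 0)"
  have "\<forall>I\<in>set ?X. \<exists>J. interval_map f I J"
  proof
    fix I assume "I \<in> set ?X"
    then have "fst I = N" "snd I < 2 ^ fst I"
      using leaf_intervals_full_tree[of I N "(0, 0)"] leaf_intervals_unit[of I "full_tree N" "(0,
          0)"] by simp_all
    then show "\<exists>J. interval_map f I J" using N by (metis prod.collapse)
  qed
  then obtain J where J: "\<forall>I\<in>set ?X. interval_map f I (J I)" by metis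
  then have all: "list_all2 (interval_map f) ?X (map J ?X)" by (simp add: list_all2_map2 list_all2_same)
  have "tiles (f (left_end (0, 0))) (map J ?X) (f (right_end (0, 0)))"
    using tiles_image[OF tiles_leaf_intervals all] .
  then have "tiles (left_end (0, 0)) (map J ?X) (right_end (0, 0))"
    using thompson_mapD[OF assms] by (simp add: left_end_def right_end_def)
  from tiling_from_tree[OF this] obtain s where "leaf_intervals s (0, 0) = map J ?X" by blast
  then show ?thesis using all unfolding tree_pair_def by metis
qed

section \<open>Incoming edges in layered diagrams\<close>

fun chain :: "nat \<Rightarrow> edge list \<Rightarrow> nat \<Rightarrow> bool" where
  "chain u [] v \<longleftrightarrow> u = v"
| "chain u (e # p) v \<longleftrightarrow> src e = u \<and> chain (tgt e) p v"

lemma chain_append [simp]: "chain u (p @ q) w \<longleftrightarrow> (\<exists>v. chain u p v \<and> chain v q w)"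
  by (induction p arbitrary: u) auto

lemma chain_verts:
  assumes "chain u p v" "w \<in> path_verts p" "w \<noteq> u"
  shows "\<exists>e\<in>set p. tgt e = w"
  using assms
proof (induction p arbitrary: u)
  case (Cons e p)
  then show ?case by (cases "w = tgt e") (auto simp: path_verts_def)
qed (simp add: path_verts_def)

text \<open>
  The shape of a cell \<open>\<pi>\<close> with top edge \<open>e\<close> and bottom path \<open>[f, g]\<close>.
\<close>

definition pi_triple :: "edge \<Rightarrow> edge \<Rightarrow> edge \<Rightarrow> bool" where
  "pi_triple e f g \<longleftrightarrow> src f = src e \<and> tgt f = src g \<and> tgt g = tgt e \<and> src e \<noteq> tgt f"

definition pi_cells :: "diagram \<Rightarrow> (edge \<times> edge \<times> edge) set" where
  "pi_cells D = {(e, f, g). ([e], [f, g]) \<in> cell_set D}"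

lemma above_mono: "cell_set A \<subseteq> cell_set B \<Longrightarrow> above A \<subseteq> above B"
  unfolding above_def by (rule trancl_mono_subset) fastforce

lemma above_trans: "(e, f) \<in> above D \<Longrightarrow> (f, g) \<in> above D \<Longrightarrow> (e, g) \<in> above D"
  unfolding above_def by (rule trancl_trans)

lemma above_cell: "(p, q) \<in> cell_set D \<Longrightarrow> e \<in> set p \<Longrightarrow> f \<in> set q \<Longrightarrow> (e, f) \<in> above D"
  unfolding above_def by (rule r_into_trancl) auto

lemma above_inverse: "above (diagram_inverse D) = (above D)\<inverse>"
proof -
  have "{(e, e'). \<exists>(p, q)\<in>prod.swap ` cell_set D. e \<in> set p \<and> e' \<in> set q}
      = {(e, e'). \<exists>(p, q)\<in>cell_set D. e \<in> set p \<and> e' \<in> set q}\<inverse>"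
    by force
  then show ?thesis
    by (simp add: above_def diagram_inverse_def trancl_converse)
qed

lemma diagram_verts_eq: "diagram_verts D = src ` edge_set D \<union> tgt ` edge_set D"
  by (simp add: digraph_of_def)

lemma diagram_simps [simp]:
  "edge_set (diagram_inverse A) = edge_set A"
  "cell_set (diagram_inverse A) = prod.swap ` cell_set A"
  "top_path (diagram_inverse A) = bot_path A"
  "bot_path (diagram_inverse A) = top_path A"
  "edge_set (diagram_mult A B) = edge_set A \<union> edge_set B"
  "cell_set (diagram_mult A B) = cell_set A \<union> cell_set B"
  "top_path (diagram_mult A B) = top_path A"
  "bot_path (diagram_mult A B) = bot_path B"
  "edge_set (diagram_add A B) = edge_set A \<union> edge_set B"
  "cell_set (diagram_add A B) = cell_set A \<union> cell_set B"
  "top_path (diagram_add A B) = top_path A @ top_path B"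
  "bot_path (diagram_add A B) = bot_path A @ bot_path B"
  "edge_set (edge_diagram e) = {e}"
  "cell_set (edge_diagram e) = {}"
  "top_path (edge_diagram e) = [e]"
  "bot_path (edge_diagram e) = [e]"
  "edge_set (pi_diagram e f g) = {e, f, g}"
  "cell_set (pi_diagram e f g) = {([e], [f, g])}"
  "top_path (pi_diagram e f g) = [e]"
  "bot_path (pi_diagram e f g) = [f, g]"
  by (simp_all add: diagram_inverse_def diagram_mult_def diagram_add_def edge_diagram_def pi_diagram_def)

lemma inverse_inverse [simp]: "diagram_inverse (diagram_inverse A) = A"
  by (cases A) (simp add: diagram_inverse_def image_image)

lemma inverse_mult: "diagram_inverse (diagram_mult A B) = diagram_mult (diagram_inverse B)
    (diagram_inverse A)"
  by (simp add: diagram_inverse_def diagram_mult_def image_Un Un_commute)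

lemma inverse_add: "diagram_inverse (diagram_add A B) = diagram_add (diagram_inverse A)
    (diagram_inverse B)"
  by (simp add: diagram_inverse_def diagram_add_def image_Un)

text \<open>
  What is needed about the planar structure of a diagram, as seen from above. No edge enters the
  initial vertex; every edge is either on the top path or on the bottom path of exactly one cell; the
  vertex in the middle of the bottom path of a cell \<open>\<pi>\<close> does not occur on the top path; and all
  edges that enter the same vertex lie below the first one, which is an edge of the top path or the
  left bottom edge of the cell \<open>\<pi>\<close> where the vertex appears. The view from below is the same
  condition on the inverse diagram. Only both views together are preserved by all the operations
  that build diagrams.
\<close>

definition layered :: "diagram \<Rightarrow> bool" where
  "layered D \<longleftrightarrow>
     finite (edge_set D) \<and>
     top_path D \<noteq> [] \<and> set (top_path D) \<subseteq> edge_set D \<and>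
     chain (initial_vertex D) (top_path D) (terminal_vertex D) \<and>
     (\<forall>e\<in>edge_set D. tgt e \<noteq> initial_vertex D) \<and>
     (\<forall>(p, q)\<in>cell_set D. set p \<union> set q \<subseteq> edge_set D \<and>
        ((\<exists>e f g. p = [e] \<and> q = [f, g] \<and> pi_triple e f g) \<or>
         (\<exists>e f g. q = [e] \<and> p = [f, g] \<and> pi_triple e f g))) \<and>
     (\<forall>e\<in>edge_set D. e \<in> set (top_path D) \<longleftrightarrow> \<not> (\<exists>(p, q)\<in>cell_set D. e \<in> set q)) \<and>
     (\<forall>c\<in>cell_set D. \<forall>d\<in>cell_set D. set (snd c) \<inter> set (snd d) \<noteq> {} \<longrightarrow> c = d) \<and>
     (\<forall>e\<in>set (top_path D). \<forall>e'\<in>edge_set D. tgt e' = tgt e \<longrightarrow> e' = e \<or> (e, e') \<in> above D) \<and>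
     (\<forall>e f g. ([e], [f, g]) \<in> cell_set D \<longrightarrow> tgt f \<notin> path_verts (top_path D) \<and>
        (\<forall>e'\<in>edge_set D. tgt e' = tgt f \<longrightarrow> e' = f \<or> (f, e') \<in> above D))"

definition ends_agree :: "diagram \<Rightarrow> bool" where
  "ends_agree D \<longleftrightarrow> initial_vertex (diagram_inverse D) = initial_vertex D
     \<and> terminal_vertex (diagram_inverse D) = terminal_vertex D"

lemma layeredD:
  assumes "layered D"
  shows "finite (edge_set D)" "top_path D \<noteq> []" "set (top_path D) \<subseteq> edge_set D"
   "chain (initial_vertex D) (top_path D) (terminal_vertex D)"
   "\<And>e. e\<in>edge_set D \<Longrightarrow> tgt e \<noteq> initial_vertex D"
   "\<And>p q. (p, q)\<in>cell_set D \<Longrightarrow> set p \<union> set q \<subseteq> edge_set D"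
   "\<And>p q. (p, q)\<in>cell_set D \<Longrightarrow> (\<exists>e f g. p = [e] \<and> q = [f, g] \<and> pi_triple e f g) \<or>
         (\<exists>e f g. q = [e] \<and> p = [f, g] \<and> pi_triple e f g)"
   "\<And>e. e\<in>edge_set D \<Longrightarrow> e \<in> set (top_path D) \<longleftrightarrow> \<not> (\<exists>(p, q)\<in>cell_set D. e \<in> set q)"
   "\<And>c d e. c\<in>cell_set D \<Longrightarrow> d\<in>cell_set D \<Longrightarrow> e \<in> set (snd c) \<Longrightarrow> e \<in> set (snd d) \<Longrightarrow> c = d"
   "\<And>e e'. e\<in>set (top_path D) \<Longrightarrow> e'\<in>edge_set D \<Longrightarrow> tgt e' = tgt e \<Longrightarrow> e' = e \<or> (e, e') \<in> above D"
   "\<And>e f g. ([e], [f, g]) \<in> cell_set D \<Longrightarrow> tgt f \<notin> path_verts (top_path D)"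
   "\<And>e f g e'. ([e], [f, g]) \<in> cell_set D \<Longrightarrow> e'\<in>edge_set D \<Longrightarrow> tgt e' = tgt f \<Longrightarrow> e' = f \<or> (f, e') \<in> above D"
proof -
  note P = assms[unfolded layered_def]
  show "finite (edge_set D)" using P by (elim conjE)
  show "top_path D \<noteq> []" using P by (elim conjE)
  show "set (top_path D) \<subseteq> edge_set D" using P by (elim conjE)
  show "chain (initial_vertex D) (top_path D) (terminal_vertex D)" using P by (elim conjE)
  have 1: "\<forall>e\<in>edge_set D. tgt e \<noteq> initial_vertex D"
    using P by (elim conjE)
  have 2: "\<forall>(p, q)\<in>cell_set D. set p \<union> set q \<subseteq> edge_set D \<and>
        ((\<exists>e f g. p = [e] \<and> q = [f, g] \<and> pi_triple e f g) \<or>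
         (\<exists>e f g. q = [e] \<and> p = [f, g] \<and> pi_triple e f g))"
    using P by (elim conjE)
  have 3: "\<forall>e\<in>edge_set D. e \<in> set (top_path D) \<longleftrightarrow> \<not> (\<exists>(p, q)\<in>cell_set D. e \<in> set q)"
    using P by (elim conjE)
  have 4: "\<forall>c\<in>cell_set D. \<forall>d\<in>cell_set D. set (snd c) \<inter> set (snd d) \<noteq> {} \<longrightarrow> c = d"
    using P by (elim conjE)
  have 5: "\<forall>e\<in>set (top_path D). \<forall>e'\<in>edge_set D. tgt e' = tgt e \<longrightarrow> e' = e \<or> (e, e') \<in> above D"
    using P by (elim conjE)
  have 6: "\<forall>e f g. ([e], [f, g]) \<in> cell_set D \<longrightarrow> tgt f \<notin> path_verts (top_path D) \<and>
        (\<forall>e'\<in>edge_set D. tgt e' = tgt f \<longrightarrow> e' = f \<or> (f, e') \<in> above D)"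
    using P by (elim conjE)
  show "\<And>e. e\<in>edge_set D \<Longrightarrow> tgt e \<noteq> initial_vertex D" using 1 by blast
  show "\<And>p q. (p, q)\<in>cell_set D \<Longrightarrow> set p \<union> set q \<subseteq> edge_set D" using 2 by blast
  show "\<And>p q. (p, q)\<in>cell_set D \<Longrightarrow> (\<exists>e f g. p = [e] \<and> q = [f, g] \<and> pi_triple e f g) \<or>
         (\<exists>e f g. q = [e] \<and> p = [f, g] \<and> pi_triple e f g)"
    by (drule bspec[OF 2]) (simp only: prod.case)
  show "\<And>e. e\<in>edge_set D \<Longrightarrow> e \<in> set (top_path D) \<longleftrightarrow> \<not> (\<exists>(p, q)\<in>cell_set D. e \<in> set q)"
    using 3 by blast
  show "\<And>c d e. c\<in>cell_set D \<Longrightarrow> d\<in>cell_set D \<Longrightarrow> e \<in> set (snd c) \<Longrightarrow> e \<in> set (snd d) \<Longrightarrow> c = d"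
    using 4 by (meson disjoint_iff)
  show "\<And>e e'. e\<in>set (top_path D) \<Longrightarrow> e'\<in>edge_set D \<Longrightarrow> tgt e' = tgt e \<Longrightarrow> e' = e \<or> (e, e') \<in> above D"
    using 5 by blast
  show "\<And>e f g. ([e], [f, g]) \<in> cell_set D \<Longrightarrow> tgt f \<notin> path_verts (top_path D)"
   "\<And>e f g e'. ([e], [f, g]) \<in> cell_set D \<Longrightarrow> e'\<in>edge_set D \<Longrightarrow> tgt e' = tgt f \<Longrightarrow> e' = f \<or> (f, e') \<in> above D"
    using 6 by blast+
qed

lemma initial_mult: "initial_vertex (diagram_mult A B) = initial_vertex A"
  by (simp add: initial_vertex_def)
lemma terminal_mult: "terminal_vertex (diagram_mult A B) = terminal_vertex A"
  by (simp add: terminal_vertex_def)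
lemma initial_add: "top_path A \<noteq> [] \<Longrightarrow> initial_vertex (diagram_add A B) = initial_vertex A"
  by (simp add: initial_vertex_def)
lemma terminal_add: "top_path B \<noteq> [] \<Longrightarrow> terminal_vertex (diagram_add A B) = terminal_vertex B"
  by (simp add: terminal_vertex_def)

lemma layered_edge: "src e \<noteq> tgt e \<Longrightarrow> layered (edge_diagram e)"
  by (auto simp: layered_def initial_vertex_def terminal_vertex_def)

lemma layered_pi:
  assumes "src f = src e" "tgt f = src g" "tgt g = tgt e" "distinct [src e, tgt f, tgt e]"
  shows "layered (pi_diagram e f g)"
proof -
  have "(e, g) \<in> above (pi_diagram e f g)" by (rule above_cell) auto
  then show ?thesis using assms
    by (auto simp: layered_def initial_vertex_def terminal_vertex_def pi_triple_def path_verts_def)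
qed

lemma layered_pi_inverse:
  assumes "src f = src e" "tgt f = src g" "tgt g = tgt e" "distinct [src e, tgt f, tgt e]"
  shows "layered (diagram_inverse (pi_diagram e f g))"
proof -
  have "(g, e) \<in> above (diagram_inverse (pi_diagram e f g))" by (rule above_cell) auto
  then show ?thesis using assms
    by (auto simp: layered_def initial_vertex_def terminal_vertex_def pi_triple_def path_verts_def)
qed

lemma path_verts_subset: "set p \<subseteq> edge_set D \<Longrightarrow> path_verts p \<subseteq> diagram_verts D"
  unfolding path_verts_def diagram_verts_eq by blast

lemma tgt_in_verts: "e \<in> edge_set D \<Longrightarrow> tgt e \<in> diagram_verts D"
  by (simp add: diagram_verts_eq)

lemma mid_in_verts: "layered D \<Longrightarrow> ([e], [f, g]) \<in> cell_set D \<Longrightarrow> tgt f \<in> diagram_verts D"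
  by (meson layeredD(6) tgt_in_verts list.set_intros(1) le_sup_iff subsetD)

lemma initial_in_top: "top_path D \<noteq> [] \<Longrightarrow> initial_vertex D \<in> path_verts (top_path D)"
  unfolding initial_vertex_def path_verts_def by (cases "top_path D") auto

lemma terminal_in_top: "top_path D \<noteq> [] \<Longrightarrow> terminal_vertex D \<in> path_verts (top_path D)"
  unfolding terminal_vertex_def path_verts_def by auto

lemma layered_add:
  assumes A: "layered A" and B: "layered B" and AB: "addable A B"
  shows "layered (diagram_add A B)"
proof -
  note a = layeredD[OF A] and b = layeredD[OF B]
  let ?D = "diagram_add A B"
  have tv: "terminal_vertex A = initial_vertex B"
    and inter: "diagram_verts A \<inter> diagram_verts B = {terminal_vertex A}"
    and disj: "edge_set A \<inter> edge_set B = {}"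
    using AB by (auto simp: addable_def)
  have ini: "initial_vertex ?D = initial_vertex A" and ter: "terminal_vertex ?D = terminal_vertex B"
    using a(2) b(2) by (simp_all add: initial_add terminal_add)
  have shared: "v = initial_vertex B" if "v \<in> diagram_verts A" "v \<in> diagram_verts B" for v
    using inter tv that by (metis Int_iff singletonD)
  have pA: "path_verts (top_path A) \<subseteq> diagram_verts A"
      and pB: "path_verts (top_path B) \<subseteq> diagram_verts B"
    using a(3) b(3) by (simp_all add: path_verts_subset)
  have iA: "initial_vertex A \<in> diagram_verts A" "terminal_vertex A \<in> path_verts (top_path A)"
    "initial_vertex B \<in> path_verts (top_path B)" "initial_vertex A \<in> path_verts (top_path A)"
    using initial_in_top a(2) terminal_in_top b(2) pA by auto
  have neq: "initial_vertex A \<noteq> terminal_vertex A"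
    using a(2,3,5) unfolding terminal_vertex_def by (metis last_in_set subsetD)
  have ab: "above A \<subseteq> above ?D" "above B \<subseteq> above ?D" by (simp_all add: above_mono)
  have pv: "path_verts (top_path ?D) = path_verts (top_path A) \<union> path_verts (top_path B)"
    by (auto simp: path_verts_def)
  have c1: "\<forall>e\<in>edge_set ?D. tgt e \<noteq> initial_vertex ?D"
    using a(5) b(5) shared iA(1) neq tgt_in_verts tv ini by fastforce
  have c2: "\<forall>(p, q)\<in>cell_set ?D. set p \<union> set q \<subseteq> edge_set ?D \<and>
        ((\<exists>e f g. p = [e] \<and> q = [f, g] \<and> pi_triple e f g) \<or>
         (\<exists>e f g. q = [e] \<and> p = [f, g] \<and> pi_triple e f g))"
    using a(6,7) b(6,7) by auto blast+
  have c3: "\<forall>e\<in>edge_set ?D. e \<in> set (top_path ?D) \<longleftrightarrow> \<not> (\<exists>(p, q)\<in>cell_set ?D. e \<in> set q)"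
  proof
    fix e assume "e \<in> edge_set ?D"
    have sA: "e \<in> edge_set A" if "(p, q) \<in> cell_set A" "e \<in> set q" for p q
      using that a(6)[OF that(1)] by auto
    have sB: "e \<in> edge_set B" if "(p, q) \<in> cell_set B" "e \<in> set q" for p q
      using that b(6)[OF that(1)] by auto
    show "e \<in> set (top_path ?D) \<longleftrightarrow> \<not> (\<exists>(p, q)\<in>cell_set ?D. e \<in> set q)"
    proof (cases "e \<in> edge_set A")
      case True
      then have "e \<notin> edge_set B" using disj by blast
      then show ?thesis using a(8)[OF True] sB b(3) by (auto simp: bex_Un)
    next
      case False
      then have "e \<in> edge_set B" using \<open>e \<in> edge_set ?D\<close> by simp
      then show ?thesis using b(8) False sA a(3) by (auto simp: bex_Un)
    qed
  qed
  have c4: "c = d" if "c\<in>cell_set ?D" "d\<in>cell_set ?D" "e \<in> set (snd c)" "e \<in> set (snd d)" for c d e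
  proof -
    have "set (snd c) \<subseteq> edge_set A" if "c \<in> cell_set A" for c using a(6) that by (cases c) auto
    moreover have "set (snd c) \<subseteq> edge_set B" if "c \<in> cell_set B" for c using b(6) that by (cases c) auto
    ultimately show ?thesis using that disj a(9) b(9) by simp blast
  qed
  have c5: "e' = e \<or> (e, e') \<in> above ?D"
    if "e\<in>set (top_path ?D)" "e'\<in>edge_set ?D" "tgt e' = tgt e" for e e'
  proof -
    have "tgt e \<noteq> initial_vertex B" if "e \<in> edge_set B" for e using b(5) that by blast
    then show ?thesis using that ab a(3,10) b(3,10) tgt_in_verts shared
      by simp (metis subsetD)
  qed
  have c6: "tgt f \<notin> path_verts (top_path ?D)"
    and c7: "e'\<in>edge_set ?D \<Longrightarrow> tgt e' = tgt f \<Longrightarrow> e' = f \<or> (f, e') \<in> above ?D"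
    if "([e], [f, g]) \<in> cell_set ?D" for e f g e'
  proof -
    have 1: "tgt f \<notin> diagram_verts B" if "([e], [f, g]) \<in> cell_set A"
      using a(11)[OF that] mid_in_verts[OF A that] shared tv iA by metis
    have 2: "tgt f \<notin> diagram_verts A" if "([e], [f, g]) \<in> cell_set B"
      using b(11)[OF that] mid_in_verts[OF B that] shared tv iA by metis
    show "tgt f \<notin> path_verts (top_path ?D)"
      using that 1 2 a(11) b(11) pv pA pB by auto
    show "e'\<in>edge_set ?D \<Longrightarrow> tgt e' = tgt f \<Longrightarrow> e' = f \<or> (f, e') \<in> above ?D"
      using that 1 2 a(12) b(12) ab tgt_in_verts by simp (metis subsetD)
  qed
  have C4: "\<forall>c\<in>cell_set ?D. \<forall>d\<in>cell_set ?D. set (snd c) \<inter> set (snd d) \<noteq> {} \<longrightarrow> c = d"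
    using c4 by (meson disjoint_iff)
  have C5: "\<forall>e\<in>set (top_path ?D). \<forall>e'\<in>edge_set ?D. tgt e' = tgt e \<longrightarrow> e' = e \<or> (e, e') \<in> above ?D"
    using c5 by blast
  have C6: "\<forall>e f g. ([e], [f, g]) \<in> cell_set ?D \<longrightarrow> tgt f \<notin> path_verts (top_path ?D) \<and>
        (\<forall>e'\<in>edge_set ?D. tgt e' = tgt f \<longrightarrow> e' = f \<or> (f, e') \<in> above ?D)"
    using c6 c7 by blast
  have C0: "finite (edge_set ?D)" "top_path ?D \<noteq> []" "set (top_path ?D) \<subseteq> edge_set ?D"
      "chain (initial_vertex ?D) (top_path ?D) (terminal_vertex ?D)"
    using a(1-4) b(1-4) tv unfolding ini ter by auto
  show ?thesis
    unfolding layered_def by (intro conjI C0 c1 c2 c3 C4 C5 C6)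
qed

text \<open>
  An edge of \<open>B\<close> that enters a vertex of \<open>A\<close> does so at a vertex of the common path. The edge of that
  path which enters the vertex lies below the first incoming edge of \<open>A\<close> and above the given edge.
\<close>

lemma layered_mult:
  assumes A: "layered A" and B: "layered B" and AB: "multipliable A B"
      and iAB: "initial_vertex A = initial_vertex B"
    and bot: "chain (initial_vertex A) (bot_path A) (terminal_vertex A)" "set (bot_path A) \<subseteq> edge_set A"
  shows "layered (diagram_mult A B)"
proof -
  note a = layeredD[OF A] and b = layeredD[OF B]
  let ?D = "diagram_mult A B"
  have eq: "bot_path A = top_path B"
    and inter: "diagram_verts A \<inter> diagram_verts B = path_verts (bot_path A)"
    and einter: "edge_set A \<inter> edge_set B = set (bot_path A)"
    using AB by (auto simp: multipliable_def)
  have ini: "initial_vertex ?D = initial_vertex A" and ter: "terminal_vertex ?D = terminal_vertex A"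
    by (simp_all add: initial_mult terminal_mult)
  have shared: "v \<in> path_verts (top_path B)" if "v \<in> diagram_verts A" "v \<in> diagram_verts B" for v
    using inter eq that by auto
  have pA: "path_verts (top_path A) \<subseteq> diagram_verts A"
    using a(3) by (simp add: path_verts_subset)
  have iA: "initial_vertex A \<in> path_verts (top_path A)"
    using initial_in_top a(2) by auto
  have ab: "above A \<subseteq> above ?D" "above B \<subseteq> above ?D" by (simp_all add: above_mono)
  have c1: "\<forall>e\<in>edge_set ?D. tgt e \<noteq> initial_vertex ?D"
    using a(5) b(5) ini iAB by fastforce
  have c2: "\<forall>(p, q)\<in>cell_set ?D. set p \<union> set q \<subseteq> edge_set ?D \<and>
        ((\<exists>e f g. p = [e] \<and> q = [f, g] \<and> pi_triple e f g) \<or>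
         (\<exists>e f g. q = [e] \<and> p = [f, g] \<and> pi_triple e f g))"
    using a(6,7) b(6,7) by auto blast+
  have c3: "e \<in> set (top_path ?D) \<longleftrightarrow> \<not> (\<exists>(p, q)\<in>cell_set ?D. e \<in> set q)" if "e\<in>edge_set ?D" for e
  proof -
    have sB: "e \<in> edge_set B \<and> e \<notin> edge_set A" if "(p, q) \<in> cell_set B" "e \<in> set q" for p q
      using that b(6)[OF that(1)] b(8)[of e] einter eq by auto
    have sA: "e \<in> edge_set A" if "(p, q) \<in> cell_set A" "e \<in> set q" for p q
      using that a(6)[OF that(1)] by auto
    show ?thesis
    proof (cases "e \<in> edge_set A")
      case True
      then show ?thesis using a(8)[OF True] sB by auto
    next
      case False
      then have "e \<in> edge_set B" "e \<notin> set (top_path B)" "e \<notin> set (top_path A)"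
        using that einter eq bot a(3) by auto
      then show ?thesis using b(8)[of e] by auto
    qed
  qed
  have c4: "c = d" if "c\<in>cell_set ?D" "d\<in>cell_set ?D" "e \<in> set (snd c)" "e \<in> set (snd d)" for c d e
  proof -
    have "set (snd c) \<subseteq> edge_set A" if "c \<in> cell_set A" for c using a(6) that by (cases c) auto
    moreover have "set (snd c) \<inter> edge_set A = {}" if "c \<in> cell_set B" for c
      using b(6,8) einter eq that by (cases c) fastforce
    ultimately show ?thesis using that a(9) b(9) by simp blast
  qed
  have below: "e' = e \<or> (e, e') \<in> above ?D"
    if "e \<in> edge_set A" "\<And>e'. e' \<in> edge_set A \<Longrightarrow> tgt e' = tgt e \<Longrightarrow> e' = e \<or> (e, e') \<in> above A"
      "e' \<in> edge_set ?D" "tgt e' = tgt e" for e e'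
  proof (cases "e' \<in> edge_set A")
    case True
    then show ?thesis using that ab by blast
  next
    case False
    then have e': "e' \<in> edge_set B" using that by simp
    have "tgt e \<in> path_verts (bot_path A)" using that(1,4) e' tgt_in_verts shared eq by metis
    then have "\<exists>b'\<in>set (bot_path A). tgt b' = tgt e"
      using chain_verts[OF bot(1)] a(5)[OF that(1)] by blast
    then obtain b' where b': "b' \<in> set (bot_path A)" "tgt b' = tgt e" by blast
    then have "b' = e \<or> (e, b') \<in> above A" using that(2) bot(2) by blast
    moreover have "e' = b' \<or> (b', e') \<in> above B" using b(10) b' e' that(4) eq by metis
    ultimately show ?thesis using ab by (meson above_trans subsetD)
  qed
  have c5: "e' = e \<or> (e, e') \<in> above ?D"
    if "e\<in>set (top_path ?D)" "e'\<in>edge_set ?D" "tgt e' = tgt e" for e e'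
    using below[OF _ _ that(2,3)] that(1) a(3,10) by (simp add: subset_iff)
  have c6: "tgt f \<notin> path_verts (top_path ?D)"
    and c7: "e'\<in>edge_set ?D \<Longrightarrow> tgt e' = tgt f \<Longrightarrow> e' = f \<or> (f, e') \<in> above ?D"
    if "([e], [f, g]) \<in> cell_set ?D" for e f g e'
  proof -
    have 2: "tgt f \<notin> diagram_verts A" if "([e], [f, g]) \<in> cell_set B"
      using b(11)[OF that] mid_in_verts[OF B that] shared by metis
    show "tgt f \<notin> path_verts (top_path ?D)"
      using that 2 a(11) pA by auto
    show "e'\<in>edge_set ?D \<Longrightarrow> tgt e' = tgt f \<Longrightarrow> e' = f \<or> (f, e') \<in> above ?D"
    proof -
      assume e': "e'\<in>edge_set ?D" "tgt e' = tgt f"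
      show ?thesis
      proof (cases "([e], [f, g]) \<in> cell_set A")
        case True
        then have "f \<in> edge_set A" using a(6) by fastforce
        then show ?thesis using below[OF _ a(12)[OF True] e'] by blast
      next
        case False
        then have B': "([e], [f, g]) \<in> cell_set B" using that by simp
        then have "e' \<in> edge_set B" using 2 e' tgt_in_verts by fastforce
        then show ?thesis using b(12)[OF B' _ e'(2)] ab by blast
      qed
    qed
  qed
  have C3: "\<forall>e\<in>edge_set ?D. e \<in> set (top_path ?D) \<longleftrightarrow> \<not> (\<exists>(p, q)\<in>cell_set ?D. e \<in> set q)"
    using c3 by blast
  have C4: "\<forall>c\<in>cell_set ?D. \<forall>d\<in>cell_set ?D. set (snd c) \<inter> set (snd d) \<noteq> {} \<longrightarrow> c = d"
    using c4 by (meson disjoint_iff)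
  have C5: "\<forall>e\<in>set (top_path ?D). \<forall>e'\<in>edge_set ?D. tgt e' = tgt e \<longrightarrow> e' = e \<or> (e, e') \<in> above ?D"
    using c5 by blast
  have C6: "\<forall>e f g. ([e], [f, g]) \<in> cell_set ?D \<longrightarrow> tgt f \<notin> path_verts (top_path ?D) \<and>
        (\<forall>e'\<in>edge_set ?D. tgt e' = tgt f \<longrightarrow> e' = f \<or> (f, e') \<in> above ?D)"
    using c6 c7 by blast
  have C0: "finite (edge_set ?D)" "top_path ?D \<noteq> []" "set (top_path ?D) \<subseteq> edge_set ?D"
      "chain (initial_vertex ?D) (top_path ?D) (terminal_vertex ?D)"
    using a(1-4) b(1-4) unfolding ini ter by auto
  show ?thesis
    unfolding layered_def by (intro conjI C0 c1 c2 C3 C4 C5 C6)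
qed

lemma verts_inverse [simp]: "diagram_verts (diagram_inverse A) = diagram_verts A"
  by (simp add: diagram_verts_eq)

lemma is_diagram_layered:
  "is_diagram D \<Longrightarrow> layered D \<and> layered (diagram_inverse D) \<and> ends_agree D"
proof (induction rule: is_diagram.induct)
  case (edge e)
  have eq: "diagram_inverse (edge_diagram e) = edge_diagram e"
    by (simp add: edge_diagram_def diagram_inverse_def)
  show ?case using layered_edge[OF edge] unfolding eq ends_agree_def by simp
next
  case (pi f e g)
  then show ?case using layered_pi layered_pi_inverse
    by (simp add: ends_agree_def initial_vertex_def terminal_vertex_def)
next
  case (add A B)
  then have IH: "layered A" "layered (diagram_inverse A)" "ends_agree A"
    "layered B" "layered (diagram_inverse B)" "ends_agree B" by auto
  then have "addable (diagram_inverse A) (diagram_inverse B)" using add(3)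
    by (simp add: addable_def ends_agree_def)
  then have 1: "layered (diagram_inverse (diagram_add A B))" unfolding inverse_add
      using IH layered_add by blast
  have "ends_agree (diagram_add A B)" using IH layeredD(2)[OF IH(1)] layeredD(2)[OF IH(2)]
      layeredD(2)[OF IH(4)] layeredD(2)[OF IH(5)]
    unfolding ends_agree_def inverse_add by (simp add: initial_add terminal_add)
  then show ?case using 1 layered_add[OF IH(1,4) add(3)] by blast
next
  case (mult A B)
  then have IH: "layered A" "layered (diagram_inverse A)" "ends_agree A"
    "layered B" "layered (diagram_inverse B)" "ends_agree B" by auto
  have m: "multipliable (diagram_inverse B) (diagram_inverse A)" using mult(3)
    unfolding multipliable_def verts_inverse diagram_simps by (simp add: Int_commute)
  have bt: "bot_path A = top_path B" using mult(3) by (simp add: multipliable_def)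
  then have i: "initial_vertex A = initial_vertex B" "terminal_vertex A = terminal_vertex B"
    using IH unfolding ends_agree_def by (auto simp: initial_vertex_def terminal_vertex_def)
  have 1: "layered (diagram_mult A B)"
    using layeredD(3,4)[OF IH(2)] IH(3)
    by (intro layered_mult[OF IH(1,4) mult(3) i(1)]) (auto simp: ends_agree_def)
  have 2: "layered (diagram_inverse (diagram_mult A B))" unfolding inverse_mult
    using layeredD(3,4)[OF IH(4)] IH(3,6) i(1)
    by (intro layered_mult[OF IH(5,2) m]) (auto simp: ends_agree_def)
  have "ends_agree (diagram_mult A B)" using IH i
    unfolding ends_agree_def inverse_mult by (simp add: initial_mult terminal_mult)
  then show ?case using 1 2 by blast
next
  case (inverse A)
  then show ?case by (auto simp: ends_agree_def)
qed

section \<open>Bipartite Thompson graphs preserve digit sum parity\<close>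

text \<open>
  The source of the upper edges of the Thompson graph: each cell \<open>\<pi>\<close> contributes the one to its middle
  vertex.
\<close>

lemma topmost_of_pi_cell:
  assumes "is_diagram D" "([e], [f, g]) \<in> cell_set D"
  shows "topmost_incoming D (tgt f) f" "tgt f \<in> inner_verts D"
proof -
  have P: "layered D" using is_diagram_layered assms by blast
  note p = layeredD[OF P]
  have f: "f \<in> edge_set D" using p(6)[OF assms(2)] by simp
  then show "topmost_incoming D (tgt f) f"
    using p(12)[OF assms(2)] by (auto simp: topmost_incoming_def incoming_def)
  show "tgt f \<in> inner_verts D"
    using p(11)[OF assms(2)] initial_in_top[OF p(2)] terminal_in_top[OF p(2)] tgt_in_verts[OF f]
    unfolding inner_verts_def by auto
qed

lemma inner_verts_inverse: "is_diagram D \<Longrightarrow> inner_verts (diagram_inverse D) = inner_verts D"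
  using is_diagram_layered[of D] by (auto simp: inner_verts_def ends_agree_def)

lemma topmost_inverse: "topmost_incoming (diagram_inverse D) = bottommost_incoming D"
  by (auto simp: topmost_incoming_def bottommost_incoming_def incoming_def above_inverse fun_eq_iff)

lemma bottommost_of_pi_inverse_cell:
  assumes "is_diagram D" "([f, g], [e]) \<in> cell_set D"
  shows "bottommost_incoming D (tgt f) f" "tgt f \<in> inner_verts D"
proof -
  have 1: "is_diagram (diagram_inverse D)" by (rule is_diagram.inverse[OF assms(1)])
  have 2: "([e], [f, g]) \<in> cell_set (diagram_inverse D)" using assms(2) by force
  show "bottommost_incoming D (tgt f) f" "tgt f \<in> inner_verts D"
    using topmost_of_pi_cell[OF 1 2] topmost_inverse inner_verts_inverse[OF assms(1)] by auto
qed

text \<open>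
  A colouring is a predicate; exchanging the two colours, if necessary, makes it false at the initial
  vertex.
\<close>

lemma bipartite_colouring:
  assumes "bipartite (thompson_graph D)"
  shows "\<exists>c. \<not> c (initial_vertex D) \<and>
    (\<forall>v\<in>inner_verts D. \<forall>e. topmost_incoming D v e \<or> bottommost_incoming D v e \<longrightarrow> c (src e) \<noteq> c (tgt e))"
proof -
  obtain U W where "verts (thompson_graph D) = U \<union> W \<and> U \<inter> W = {} \<and> (\<forall>e\<in>arcs (thompson_graph D).
     tail (thompson_graph D) e \<in> U \<and> head (thompson_graph D) e \<in> W \<or>
     tail (thompson_graph D) e \<in> W \<and> head (thompson_graph D) e \<in> U)"
    using assms unfolding bipartite_def by (elim exE)
  then have UW: "U \<inter> W = {}" and col: "\<forall>e\<in>arcs (thompson_graph D).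
     tail (thompson_graph D) e \<in> U \<and> head (thompson_graph D) e \<in> W \<or>
     tail (thompson_graph D) e \<in> W \<and> head (thompson_graph D) e \<in> U" by simp_all
  define c where "c v \<longleftrightarrow> (v \<in> U) \<noteq> (initial_vertex D \<in> U)" for v
  have "c (src e) \<noteq> c (tgt e)" if v: "v \<in> inner_verts D" and e: "topmost_incoming D v e \<or>
      bottommost_incoming D v e"
    for v e
  proof -
    have "src e \<in> U \<and> tgt e \<in> W \<or> src e \<in> W \<and> tgt e \<in> U"
      using e
    proof
      assume "topmost_incoming D v e"
      then have "Inl e \<in> arcs (thompson_graph D)" using v by (auto simp: thompson_graph_def)
      from bspec[OF col this] show ?thesis by (simp add: thompson_graph_def)
    next
      assume "bottommost_incoming D v e"
      then have "Inr e \<in> arcs (thompson_graph D)" using v by (auto simp: thompson_graph_def)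
      from bspec[OF col this] show ?thesis by (simp add: thompson_graph_def)
    qed
    then show ?thesis using UW unfolding c_def by blast
  qed
  then show ?thesis by (intro exI[of _ c]) (auto simp: c_def)
qed

lemma not_top_of_cell:
  assumes "layered P" "(p, q) \<in> cell_set P" "e \<in> set q"
  shows "e \<in> edge_set P" "e \<notin> set (top_path P)"
proof -
  show "e \<in> edge_set P" using layeredD(6)[OF assms(1,2)] assms(3) by blast
  from layeredD(8)[OF assms(1) this] show "e \<notin> set (top_path P)" using assms(2,3) by blast
qed

lemma assigned_edge:
  assumes P: "layered P" and "assigned P e a b"
  shows "e \<in> edge_set P"
  using assms(2)
proof cases
  case top
  then show ?thesis using layeredD(3)[OF P] by simp
next
  case (left e' g b')
  then show ?thesis using not_top_of_cell(1)[OF P left(2)] by simp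
next
  case (right e' f a')
  then show ?thesis using not_top_of_cell(1)[OF P right(2)] by simp
qed

lemma pi_cell_triple:
  assumes "layered P" "([e], [f, g]) \<in> cell_set P"
  shows "pi_triple e f g"
  using layeredD(7)[OF assms] by auto

lemma assigned_unique:
  assumes P: "layered P" and "assigned P e a b" "assigned P e a' b'"
  shows "a' = a \<and> b' = b"
  using assms(2,3)
proof (induction arbitrary: a' b' rule: assigned.induct)
  case (top e)
  then have no: "(p, q) \<in> cell_set P \<Longrightarrow> e \<notin> set q" for p q
    using not_top_of_cell(2)[OF P] by fastforce
  show ?case using top(2)
  proof cases
    case (left e f)
    then show ?thesis using no[OF left(2)] by simp
  next
    case (right e g)
    then show ?thesis using no[OF right(2)] by simp
  qed simp
next
  case (left e f g a b)
  have fg: "f \<noteq> g" using pi_cell_triple[OF P left(1)] by (auto simp: pi_triple_def)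
  have f: "f \<notin> set (top_path P)" using not_top_of_cell(2)[OF P left(1)] by simp
  show ?case using left(4)
  proof cases
    case top
    then show ?thesis using f by simp
  next
    case (left e' g' b'')
    have "([e'], [f, g']) = ([e], [f, g])"
      by (rule layeredD(9)[OF P left(2) \<open>([e], [f, g]) \<in> cell_set P\<close>, of f]) auto
    then show ?thesis using left(1,3) \<open>\<And>a' b'. assigned P e a' b' \<Longrightarrow> a' = a \<and> b' = b\<close> by auto
  next
    case (right e' f' a'')
    have "([e'], [f', f]) = ([e], [f, g])"
      by (rule layeredD(9)[OF P right(2) \<open>([e], [f, g]) \<in> cell_set P\<close>, of f]) auto
    then show ?thesis using fg by simp
  qed
next
  case (right e f g a b)
  have fg: "f \<noteq> g" using pi_cell_triple[OF P right(1)] by (auto simp: pi_triple_def)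
  have g: "g \<notin> set (top_path P)" using not_top_of_cell(2)[OF P right(1)] by simp
  show ?case using right(4)
  proof cases
    case top
    then show ?thesis using g by simp
  next
    case (left e' g' b'')
    have "([e'], [g, g']) = ([e], [f, g])"
      by (rule layeredD(9)[OF P left(2) \<open>([e], [f, g]) \<in> cell_set P\<close>, of g]) auto
    then show ?thesis using fg by simp
  next
    case (right e' f' a'')
    have "([e'], [f', g]) = ([e], [f, g])"
      by (rule layeredD(9)[OF P right(2) \<open>([e], [f, g]) \<in> cell_set P\<close>, of g]) auto
    then show ?thesis using right(1,3) \<open>\<And>a' b'. assigned P e a' b' \<Longrightarrow> a' = a \<and> b' = b\<close> by auto
  qed
qed

text \<open>
  The intervals attached to edges by the tree of cells are dyadic, and the colour of the vertex where
  an edge starts is forced to be the digit sum parity of the left end of its interval: the left bottom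
  edge of a cell keeps the starting vertex, while the right one starts at the middle vertex, whose
  colour changes just as appending a digit \<open>1\<close> changes parity.
\<close>

lemma assigned_colour:
  assumes P: "layered P" and ini: "\<not> c (initial_vertex P)"
    and cells: "\<And>e f g. ([e], [f, g]) \<in> cell_set P \<Longrightarrow> c (src f) \<noteq> c (tgt f)"
    and "assigned P e a b"
  shows "\<exists>k m. m < 2 ^ k \<and> a = left_end (k, m) \<and> b = right_end (k, m) \<and> c (src e) = thue_morse m"
  using assms(4)
proof induction
  case (top e)
  then show ?case using ini by (intro exI[of _ 0]) (simp add: left_end_def right_end_def
      initial_vertex_def)
next
  case (left e f g a b)
  then obtain k m where "m < 2 ^ k" "a = left_end (k, m)" "b = right_end (k, m)" "c (src e) =
      thue_morse m" by blast
  then show ?case using pi_cell_triple[OF P left(1)]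
    by (intro exI[of _ "Suc k"] exI[of _ "2 * m"]) (simp add: half_ends pi_triple_def)
next
  case (right e f g a b)
  then obtain k m where "m < 2 ^ k" "a = left_end (k, m)" "b = right_end (k, m)" "c (src e) =
      thue_morse m" by blast
  then show ?case using pi_cell_triple[OF P right(1)] cells[OF right(1)]
    by (intro exI[of _ "Suc k"] exI[of _ "Suc (2 * m)"]) (auto simp: half_ends pi_triple_def)
qed

text \<open>
  Since there are finitely many edges, some edge has a shortest interval among those that contain \<open>x\<close>.
  If it were not on the bottom path, one half of its interval would be shorter still.
\<close>

lemma assigned_cover:
  assumes P: "layered P" "layered (diagram_inverse P)" and pi: "\<forall>c\<in>cell_set P. is_pi_cell c"
    and top: "top_path P = [e0]" and x: "0 \<le> x" "x < 1"
  shows "\<exists>e\<in>set (bot_path P). \<exists>a b. assigned P e a b \<and> a \<le> x \<and> x < b"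
proof -
  define Q where "Q = {(e, a, b). assigned P e a b \<and> a \<le> x \<and> x < b}"
  have "inj_on fst Q" using assigned_unique[OF P(1)] by (fastforce simp: inj_on_def Q_def)
  moreover have "fst ` Q \<subseteq> edge_set P" using assigned_edge[OF P(1)] by (auto simp: Q_def)
  ultimately have "finite Q" using layeredD(1)[OF P(1)] by (rule inj_on_finite)
  moreover have "(e0, 0, 1) \<in> Q" using assigned.top[OF top] x by (simp add: Q_def)
  ultimately obtain q where q: "q \<in> Q" "\<forall>q'\<in>Q. snd (snd q) - fst (snd q) \<le> snd (snd q') - fst (snd q')"
    using ex_min_if_finite[of "(\<lambda>q. snd (snd q) - fst (snd q)) ` Q"]
    by (metis (no_types, lifting) empty_iff finite_imageI image_iff linorder_not_less image_is_empty)
  obtain e a b where qe: "q = (e, a, b)" by (cases q)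
  have ass: "assigned P e a b" and ab: "a \<le> x" "x < b" using q(1) by (auto simp: qe Q_def)
  have min: "b - a \<le> b' - a'" if "assigned P e' a' b'" "a' \<le> x" "x < b'" for e' a' b'
    using q(2) that by (force simp: qe Q_def)
  have "e \<in> set (bot_path P)"
  proof (rule ccontr)
    assume "e \<notin> set (bot_path P)"
    then obtain p q where pq: "(p, q) \<in> cell_set P" "e \<in> set p"
      using layeredD(8)[OF P(2), of e] assigned_edge[OF P(1) ass] by auto
    then have "is_pi_cell (p, q)" using pi by blast
    then obtain f g where cell: "([e], [f, g]) \<in> cell_set P"
      using layeredD(7)[OF P(1) pq(1)] pq by (auto simp: is_pi_cell_def)
    show False
      using min[OF assigned.left[OF cell ass]] min[OF assigned.right[OF cell ass]] ab
      by (cases "x < (a + b) / 2") (auto simp: field_simps)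
  qed
  then show ?thesis using ass ab by blast
qed

definition preserves_parity :: "(real \<Rightarrow> real) \<Rightarrow> bool" where
  "preserves_parity f \<longleftrightarrow> (\<forall>x\<in>{0..1}. f x \<in> odd_dyadics \<longleftrightarrow> x \<in> odd_dyadics)"

lemma preserves_parityI:
  assumes "thompson_map f"
    and "\<And>x. 0 \<le> x \<Longrightarrow> x < 1 \<Longrightarrow> \<exists>k m l m'. interval_map f (k, m) (l, m') \<and> m < 2 ^ k \<and> m' < 2 ^ l \<and>
        thue_morse m = thue_morse m'
       \<and> left_end (k, m) \<le> x \<and> x < right_end (k, m)"
  shows "preserves_parity f"
  unfolding preserves_parity_def
proof
  fix x :: real assume x: "x \<in> {0..1}"
  show "f x \<in> odd_dyadics \<longleftrightarrow> x \<in> odd_dyadics"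
  proof (cases "x = 1")
    case True
    then show ?thesis using thompson_mapD(5)[OF assms(1)] by simp
  next
    case False
    then obtain k m l m' where km: "interval_map f (k, m) (l, m')" "m < 2 ^ k" "m' < 2 ^ l"
        "thue_morse m = thue_morse m'"
       "left_end (k, m) \<le> x" "x < right_end (k, m)" using assms(2)[of x] x by auto
    define u where "u = x * 2 ^ k - real m"
    have u: "x = (real m + u) / 2 ^ k" "0 \<le> u" "u < 1"
      using km(5,6) by (auto simp: u_def left_end_def right_end_def field_simps)
    show ?thesis unfolding u(1) by (rule interval_map_parity[OF km(1-4) u(2,3)])
  qed
qed

text \<open>
  One colouring serves for both subdivisions, so the intervals of an edge on the common path
  start at points of equal parity.
\<close>

lemma jones_preserves_parity:
  assumes "f \<in> jones_subgroup"
  shows "preserves_parity f"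
proof -
  obtain D where f: "thompson_map f" and D: "diagram_in_F D" "represents D f" "bipartite
      (thompson_graph D)"
    using assms by (auto simp: jones_subgroup_def)
  obtain P N where PN: "is_diagram P" "is_diagram N" "multipliable P N" "D = diagram_mult P N"
    and pi: "\<forall>c\<in>cell_set P. is_pi_cell c" and pii: "\<forall>c\<in>cell_set N. is_pi_inverse_cell c"
    and lin: "\<forall>e\<in>set (bot_path P). \<exists>a b c d.
        assigned P e a b \<and> assigned (diagram_inverse N) e c d \<and> maps_linearly f a b c d"
    using D(2) unfolding represents_def by blast
  have isD: "is_diagram D" and len: "length (top_path D) = 1" using D(1) by (auto simp: diagram_in_F_def)
  then obtain e0 where top: "top_path P = [e0]" using PN(4) by (cases "top_path P") auto
  have pl: "layered P" "layered (diagram_inverse P)" "layered (diagram_inverse N)"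
    using is_diagram_layered PN(1,2) by auto
  obtain c where c0: "\<not> c (initial_vertex D)" and
    c: "\<And>v e. v\<in>inner_verts D \<Longrightarrow> topmost_incoming D v e \<or> bottommost_incoming D v e \<Longrightarrow>
        c (src e) \<noteq> c (tgt e)"
    using bipartite_colouring[OF D(3)] by blast
  have iP: "initial_vertex P = initial_vertex D" using PN(4) by (simp add: initial_mult)
  have iN: "initial_vertex (diagram_inverse N) = initial_vertex D"
  proof -
    have "initial_vertex (diagram_inverse N) = initial_vertex (diagram_inverse D)"
      using PN(4) by (simp add: inverse_mult initial_mult)
    then show ?thesis using is_diagram_layered[OF isD] by (simp add: ends_agree_def)
  qed
  have cP: "c (src f) \<noteq> c (tgt f)" if "([e], [f, g]) \<in> cell_set P" for e f g
  proof -
    have "([e], [f, g]) \<in> cell_set D" using that PN(4) by simp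
    from topmost_of_pi_cell[OF isD this] show ?thesis using c by blast
  qed
  have cN: "c (src f) \<noteq> c (tgt f)" if "([e], [f, g]) \<in> cell_set (diagram_inverse N)" for e f g
  proof -
    have "([f, g], [e]) \<in> cell_set D" using that PN(4) by auto
    from bottommost_of_pi_inverse_cell[OF isD this] show ?thesis using c by blast
  qed
  show ?thesis
  proof (rule preserves_parityI[OF f])
    fix x :: real assume x: "0 \<le> x" "x < 1"
    obtain e a b where e: "e \<in> set (bot_path P)" "assigned P e a b" "a \<le> x" "x < b"
      using assigned_cover[OF pl(1,2) pi top x] by blast
    then obtain a' b' c' d' where e': "assigned P e a' b'" "assigned (diagram_inverse N) e c' d'"
        "maps_linearly f a' b' c' d'"
      using lin by blast
    then have [simp]: "a' = a" "b' = b" using assigned_unique[OF pl(1) e(2)] by auto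
    have "\<exists>k m. m < 2 ^ k \<and> a = left_end (k, m) \<and> b = right_end (k, m) \<and> c (src e) = thue_morse m"
      by (rule assigned_colour[where c = c, OF pl(1) c0[folded iP] _ e(2)]) (rule cP)
    then obtain k m where km: "m < 2 ^ k" "a = left_end (k, m)" "b = right_end (k, m)" "c (src e) =
        thue_morse m" by blast
    have "\<exists>l m'. m' < 2 ^ l \<and> c' = left_end (l, m') \<and> d' = right_end (l, m') \<and> c (src e) = thue_morse m'"
      by (rule assigned_colour[where c = c, OF pl(3) c0[folded iN] _ e'(2)]) (rule cN)
    then obtain l m' where lm: "m' < 2 ^ l" "c' = left_end (l, m')" "d' = right_end (l, m')" "c (src
        e) = thue_morse m'" by blast
    have "interval_map f (k, m) (l, m')" unfolding interval_map_iff_maps_linearly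
        using e'(3) km lm by simp
    then show "\<exists>k m l m'. interval_map f (k, m) (l, m') \<and> m < 2 ^ k \<and> m' < 2 ^ l \<and>
        thue_morse m = thue_morse m'
       \<and> left_end (k, m) \<le> x \<and> x < right_end (k, m)"
      using km lm e by blast
  qed
qed

section \<open>Diagrams of pairs of trees\<close>

text \<open>
  An edge is determined by its end points and a label. Labels keep the two trees of a diagram apart:
  leaves, which are common to both trees, have label \<open>0\<close>, all other edges the label \<open>q\<close> of their tree.
\<close>

definition root_edge :: "nat \<Rightarrow> tree \<Rightarrow> nat \<Rightarrow> edge" where
  "root_edge q t i = Edge (if t = Leaf then 0 else q) i (i + width t)"

text \<open>
  The diagram of cells \<open>\<pi>\<close> whose vertices are the \<open>width t + 1\<close> natural numbers from \<open>i\<close> on, ordered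
  from left to right.
\<close>

fun tree_diagram :: "nat \<Rightarrow> tree \<Rightarrow> nat \<Rightarrow> diagram" where
  "tree_diagram q Leaf i = edge_diagram (root_edge q Leaf i)"
| "tree_diagram q (Node l r) i =
     diagram_mult (pi_diagram (root_edge q (Node l r) i) (root_edge q l i) (root_edge q r (i + width l)))
       (diagram_add (tree_diagram q l i) (tree_diagram q r (i + width l)))"

lemma width_ne_0 [simp]: "width t \<noteq> 0"
  using width_pos[of t] by (simp del: width_pos)

lemma root_edge_simps [simp]:
  "src (root_edge q t i) = i" "tgt (root_edge q t i) = i + width t"
  by (simp_all add: root_edge_def)

lemma tree_diagram_top [simp]: "top_path (tree_diagram q t i) = [root_edge q t i]"
  by (cases t) simp_all

lemma tree_diagram_bot: "bot_path (tree_diagram q t i) = map (\<lambda>j. Edge 0 j (Suc j)) [i..<i + width t]"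
proof (induction t arbitrary: i)
  case (Node l r)
  have "[i..<i + (width l + width r)] = [i..<i + width l] @ [i + width l..<i + width l + width r]"
    using upt_add_eq_append[of i "i + width l" "width r"] by (simp add: add.assoc)
  then show ?case using Node by (simp add: add.assoc)
qed (simp add: root_edge_def)

lemma root_edge_in: "root_edge q t i \<in> edge_set (tree_diagram q t i)"
  by (cases t) simp_all

lemma tree_diagram_edge:
  "e \<in> edge_set (tree_diagram q t i) \<Longrightarrow>
   i \<le> src e \<and> src e < tgt e \<and> tgt e \<le> i + width t \<and> (label e = 0 \<and> tgt e = Suc (src e) \<or> label e = q)"
proof (induction t arbitrary: i)
  case (Node l r)
  have 1: ?case if "e \<in> edge_set (tree_diagram q l i)" using Node.IH(1)[OF that] by auto
  have 2: ?case if "e \<in> edge_set (tree_diagram q r (i + width l))" using Node.IH(2)[OF that] by auto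
  have "e = root_edge q (Node l r) i \<or> e \<in> edge_set (tree_diagram q l i) \<or>
      e \<in> edge_set (tree_diagram q r (i + width l))"
    using Node.prems root_edge_in by auto
  then show ?case using 1 2 width_pos[of l] by (auto simp: root_edge_def)
qed (simp add: root_edge_def)

lemma tree_diagram_verts: "diagram_verts (tree_diagram q t i) = {i..i + width t}"
proof (induction t arbitrary: i)
  case (Node l r)
  have "diagram_verts (tree_diagram q (Node l r) i)
    = diagram_verts (pi_diagram (root_edge q (Node l r) i) (root_edge q l i) (root_edge q r (i +
        width l)))
      \<union> diagram_verts (tree_diagram q l i) \<union> diagram_verts (tree_diagram q r (i + width l))"
    by (simp only: diagram_verts_eq tree_diagram.simps diagram_simps image_Un Un_ac)
  also have "\<dots> = {i..i + width (Node l r)}"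
    unfolding Node by (auto simp: diagram_verts_eq)
  finally show ?case .
qed (auto simp: diagram_verts_eq)

lemma root_edge_notin_subtree:
  "e \<in> edge_set (tree_diagram q l i) \<Longrightarrow> e \<noteq> root_edge q (Node l r) i"
  "e \<in> edge_set (tree_diagram q r (i + width l)) \<Longrightarrow> e \<noteq> root_edge q (Node l r) i"
  using tree_diagram_edge[of e q l i] tree_diagram_edge[of e q r "i + width l"] width_pos[of l]
      width_pos[of r]
  by auto

lemma tree_diagram_is_diagram: "is_diagram (tree_diagram q t i)"
proof (induction t arbitrary: i)
  case Leaf
  show ?case by (simp add: is_diagram.edge)
next
  case (Node l r)
  let ?A = "tree_diagram q l i" and ?B = "tree_diagram q r (i + width l)"
  have tv: "terminal_vertex ?A = i + width l" by (simp add: terminal_vertex_def)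
  have AB: "addable ?A ?B"
    unfolding addable_def tv tree_diagram_verts
  proof (intro conjI)
    show "i + width l = initial_vertex ?B" by (simp add: initial_vertex_def)
    show "edge_set ?A \<inter> edge_set ?B = {}"
      using tree_diagram_edge[of _ q l i] tree_diagram_edge[of _ q r "i + width l"] by fastforce
  qed auto
  let ?P = "pi_diagram (root_edge q (Node l r) i) (root_edge q l i) (root_edge q r (i + width l))"
  have "is_diagram ?P"
    using width_pos[of l] width_pos[of r]
        by (intro is_diagram.pi) (simp_all add: add.assoc del: width_pos)
  moreover have "multipliable ?P (diagram_add ?A ?B)"
    unfolding multipliable_def
  proof (intro conjI)
    have "diagram_verts (diagram_add ?A ?B) = {i..i + width l + width r}"
    proof -
      have "diagram_verts (diagram_add ?A ?B) = diagram_verts ?A \<union> diagram_verts ?B"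
        unfolding diagram_verts_eq diagram_simps image_Un by blast
      also have "\<dots> = {i..i + width l} \<union> {i + width l..i + width l + width r}"
        unfolding tree_diagram_verts ..
      also have "\<dots> = {i..i + width l + width r}" by (rule ivl_disj_un_two_touch(4)) simp_all
      finally show ?thesis .
    qed
    then show "diagram_verts ?P \<inter> diagram_verts (diagram_add ?A ?B) = path_verts (bot_path ?P)"
      by (auto simp: diagram_verts_eq path_verts_def)
    show "edge_set ?P \<inter> edge_set (diagram_add ?A ?B) = set (bot_path ?P)"
      using root_edge_notin_subtree[of _ q l i r] root_edge_notin_subtree(2)[of _ q r i l]
          root_edge_in by auto
  qed simp
  ultimately show ?case using is_diagram.mult is_diagram.add[OF Node AB] by simp
qed

lemma tree_diagram_cell:
  "(p, p') \<in> cell_set (tree_diagram q t i) \<Longrightarrow> \<exists>e f g. p = [e] \<and> p' = [f, g] \<and> label e = q \<and>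
    tgt f - src f < tgt e - src e \<and> tgt g - src g < tgt e - src e \<and>
    e \<in> edge_set (tree_diagram q t i) \<and> f \<in> edge_set (tree_diagram q t i) \<and>
        g \<in> edge_set (tree_diagram q t i)"
proof (induction t arbitrary: i)
  case (Node l r)
  have "(p, p') = ([root_edge q (Node l r) i], [root_edge q l i, root_edge q r (i + width l)])
    \<or> (p, p') \<in> cell_set (tree_diagram q l i) \<or> (p, p') \<in> cell_set (tree_diagram q r (i + width l))"
    using Node.prems by simp
  then show ?case
  proof (elim disjE)
    assume "(p, p') = ([root_edge q (Node l r) i], [root_edge q l i, root_edge q r (i + width l)])"
    then show ?thesis using width_pos[of l] width_pos[of r]
        by (auto simp: root_edge_def simp del: width_pos)
  next
    assume "(p, p') \<in> cell_set (tree_diagram q l i)"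
    from Node.IH(1)[OF this] show ?thesis by auto
  next
    assume "(p, p') \<in> cell_set (tree_diagram q r (i + width l))"
    from Node.IH(2)[OF this] show ?thesis by auto
  qed
qed simp

lemma tree_diagram_mid:
  "i < v \<Longrightarrow> v < i + width t \<Longrightarrow> \<exists>e f g. ([e], [f, g]) \<in> cell_set (tree_diagram q t i) \<and> tgt f = v"
proof (induction t arbitrary: i)
  case (Node l r)
  consider "v = i + width l" | "v < i + width l" | "i + width l < v" by linarith
  then show ?case
  proof cases
    case 1
    then show ?thesis
      by (intro exI[of _ "root_edge q (Node l r) i"] exI[of _ "root_edge q l i"] exI[of _ "root_edge
          q r (i + width l)"]) simp
  next
    case 2
    then show ?thesis using Node.IH(1)[of i] Node.prems by auto
  next
    case 3
    then show ?thesis using Node.IH(2)[of "i + width l"] Node.prems by auto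
  qed
qed simp

text \<open>
  Numbering the intervals of the subdivision by the vertices where they start, the digit sum parity of
  left ends is a proper colouring of the edges that run from the left end to the middle of a cell.
\<close>

lemma tree_diagram_parity:
  "([e], [f, g]) \<in> cell_set (tree_diagram q t i) \<Longrightarrow>
   i \<le> src f \<and> src f < tgt f \<and> tgt f < i + width t \<and>
   thue_morse (snd (leaf_intervals t I ! (src f - i))) \<noteq> thue_morse (snd (leaf_intervals t I ! (tgt
       f - i)))"
proof (induction t arbitrary: i I)
  case (Node l r)
  let ?L = "leaf_intervals l (Suc (fst I), 2 * snd I)"
      and ?R = "leaf_intervals r (Suc (fst I), Suc (2 * snd I))"
  have "([e], [f, g]) = ([root_edge q (Node l r) i], [root_edge q l i, root_edge q r (i + width l)])
    \<or> ([e], [f, g]) \<in> cell_set (tree_diagram q l i) \<or>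
        ([e], [f, g]) \<in> cell_set (tree_diagram q r (i + width l))"
    using Node.prems by simp
  then show ?case
  proof (elim disjE)
    assume "([e], [f, g]) = ([root_edge q (Node l r) i], [root_edge q l i, root_edge q r (i + width l)])"
    then have f: "f = root_edge q l i" by simp
    have "?L ! 0 = hd ?L" "?R ! 0 = hd ?R" by (simp_all add: hd_conv_nth)
    then show ?thesis using thue_morse_hd_leaf_intervals[of l "(Suc (fst I), 2 * snd I)"]
      thue_morse_hd_leaf_intervals[of r "(Suc (fst I), Suc (2 * snd I))"]
      by (simp add: f nth_append)
  next
    assume "([e], [f, g]) \<in> cell_set (tree_diagram q l i)"
    from Node.IH(1)[OF this, of "(Suc (fst I), 2 * snd I)"] show ?thesis by (auto simp: nth_append)
  next
    assume "([e], [f, g]) \<in> cell_set (tree_diagram q r (i + width l))"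
    from Node.IH(2)[OF this, of "(Suc (fst I), Suc (2 * snd I))"] show ?thesis
      by (auto simp: nth_append)
  qed
qed simp

lemma tree_diagram_assigned:
  assumes "cell_set (tree_diagram q t i) \<subseteq> cell_set P" "assigned P (root_edge q t i) (left_end I)
      (right_end I)" "j < width t"
  shows "assigned P (Edge 0 (i + j) (Suc (i + j))) (left_end (leaf_intervals t I ! j)) (right_end
      (leaf_intervals t I ! j))"
  using assms
proof (induction t arbitrary: i I j)
  case Leaf
  then show ?case by (simp add: root_edge_def)
next
  case (Node l r)
  obtain k m where I: "I = (k, m)" by (cases I)
  have cell: "([root_edge q (Node l r) i], [root_edge q l i, root_edge q r (i + width l)]) \<in> cell_set P"
    using Node.prems by auto
  have l: "assigned P (root_edge q l i) (left_end (Suc k, 2 * m)) (right_end (Suc k, 2 * m))"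
    using assigned.left[OF cell Node.prems(2)] unfolding I half_ends .
  have r: "assigned P (root_edge q r (i + width l)) (left_end (Suc k, Suc (2 * m))) (right_end (Suc
      k, Suc (2 * m)))"
    using assigned.right[OF cell Node.prems(2)] unfolding I half_ends .
  show ?case
  proof (cases "j < width l")
    case True
    then show ?thesis using Node.IH(1)[OF _ l True] Node.prems by (simp add: nth_append I)
  next
    case False
    then show ?thesis using Node.IH(2)[OF _ r, of "j - width l"] Node.prems by (simp add: nth_append I)
  qed
qed

definition left_half :: "nat \<times> nat \<Rightarrow> nat \<times> nat" where "left_half I = (Suc (fst I), 2 * snd I)"
definition right_half :: "nat \<times> nat \<Rightarrow> nat \<times> nat" where "right_half I = (Suc (fst I), Suc (2 * snd I))"

text \<open>
  Removing the cell above two neighbouring leaves undoes one bisection; this is what makes a pair of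
  trees smaller in the presence of a dipole.
\<close>

lemma tree_caret:
  assumes "0 < q" "([e], [Edge 0 j (Suc j), Edge 0 (Suc j) (Suc (Suc j))]) \<in> cell_set (tree_diagram
      q t i)"
  shows "\<exists>t'. \<forall>I. \<exists>X K Y. length X = j - i \<and> leaf_intervals t I = X @ [left_half K, right_half K] @ Y
      \<and> leaf_intervals t' I = X @ [K] @ Y"
  using assms(2)
proof (induction t arbitrary: i)
  case (Node l r)
  let ?p = "[Edge 0 j (Suc j), Edge 0 (Suc j) (Suc (Suc j))]"
  have "([e], ?p) = ([root_edge q (Node l r) i], [root_edge q l i, root_edge q r (i + width l)])
    \<or> ([e], ?p) \<in> cell_set (tree_diagram q l i) \<or> ([e], ?p) \<in> cell_set (tree_diagram q r (i + width l))"
    using Node.prems by simp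
  then show ?case
  proof (elim disjE)
    assume "([e], ?p) = ([root_edge q (Node l r) i], [root_edge q l i, root_edge q r (i + width l)])"
    then have "l = Leaf" "r = Leaf" "j = i" using assms(1) by (auto simp: root_edge_def split: if_splits)
    then show ?thesis
      by (intro exI[of _ Leaf] allI) (rule exI[of _ "[]"], simp add: left_half_def right_half_def)
  next
    assume "([e], ?p) \<in> cell_set (tree_diagram q l i)"
    from Node.IH(1)[OF this] obtain l' where l': "\<forall>I. \<exists>X K Y. length X = j - i \<and>
        leaf_intervals l I = X @ [left_half K, right_half K] @ Y
      \<and> leaf_intervals l' I = X @ [K] @ Y" by blast
    show ?thesis
    proof (intro exI[of _ "Node l' r"] allI)
      fix I
      obtain X K Y where "length X = j - i" "leaf_intervals l (left_half I) = X @ [left_half K,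
          right_half K] @ Y"
        "leaf_intervals l' (left_half I) = X @ [K] @ Y" using l' by blast
      then show "\<exists>X K Y. length X = j - i \<and>
          leaf_intervals (Node l r) I = X @ [left_half K, right_half K] @ Y
        \<and> leaf_intervals (Node l' r) I = X @ [K] @ Y"
        by (intro exI[of _ X] exI[of _ K] exI[of _ "Y @ leaf_intervals r (right_half I)"])
           (simp add: left_half_def right_half_def)
    qed
  next
    assume c: "([e], ?p) \<in> cell_set (tree_diagram q r (i + width l))"
    from Node.IH(2)[OF this] obtain r' where r': "\<forall>I. \<exists>X K Y. length X = j - (i + width l) \<and>
        leaf_intervals r I = X @ [left_half K, right_half K] @ Y
      \<and> leaf_intervals r' I = X @ [K] @ Y" by blast
    have j: "j \<ge> i + width l" using tree_diagram_parity[OF c] by simp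
    show ?thesis
    proof (intro exI[of _ "Node l r'"] allI)
      fix I
      obtain X K Y where "length X = j - (i + width l)" "leaf_intervals r (right_half I) = X @
          [left_half K, right_half K] @ Y"
        "leaf_intervals r' (right_half I) = X @ [K] @ Y" using r' by blast
      then show "\<exists>X K Y. length X = j - i \<and>
          leaf_intervals (Node l r) I = X @ [left_half K, right_half K] @ Y
        \<and> leaf_intervals (Node l r') I = X @ [K] @ Y" using j
        by (intro exI[of _ "leaf_intervals l (left_half I) @ X"] exI[of _ K] exI[of _ Y])
           (simp add: left_half_def right_half_def)
    qed
  qed
qed simp

lemma interval_map_merge:
  assumes "interval_map f (left_half I) (left_half J)" "interval_map f (right_half I) (right_half J)"
  shows "interval_map f I J"
  unfolding interval_map_def
proof
  fix u :: real assume u: "u \<in> {0..1}"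
  show "f ((real (snd I) + u) / 2 ^ fst I) = (real (snd J) + u) / 2 ^ fst J"
  proof (cases "u \<le> 1 / 2")
    case True
    then have "2 * u \<in> {0..1}" using u by auto
    with assms(1) have "f ((real (2 * snd I) + 2 * u) / 2 ^ Suc (fst I)) = (real (2 * snd J) + 2 *
        u) / 2 ^ Suc (fst J)"
      unfolding interval_map_def left_half_def by simp
    moreover have "(real (2 * m) + 2 * u) / 2 ^ Suc k = (real m + u) / 2 ^ k" for m k
        by (simp add: field_simps)
    ultimately show ?thesis by (simp only:)
  next
    case False
    then have "2 * u - 1 \<in> {0..1}" using u by auto
    with assms(2) have "f ((real (Suc (2 * snd I)) + (2 * u - 1)) / 2 ^ Suc (fst I)) = (real (Suc (2
        * snd J)) + (2 * u - 1)) / 2 ^ Suc (fst J)"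
      unfolding interval_map_def right_half_def fst_conv snd_conv by blast
    moreover have "(real (Suc (2 * m)) + (2 * u - 1)) / 2 ^ Suc k = (real m + u) / 2 ^ k" for m k
        by (simp add: field_simps)
    ultimately show ?thesis by (simp only:)
  qed
qed

lemma tree_pair_reduce:
  assumes "tree_pair f t s" "0 < q" "0 < q'"
    "([e], [Edge 0 j (Suc j), Edge 0 (Suc j) (Suc (Suc j))]) \<in> cell_set (tree_diagram q t 0)"
    "([e'], [Edge 0 j (Suc j), Edge 0 (Suc j) (Suc (Suc j))]) \<in> cell_set (tree_diagram q' s 0)"
  shows "\<exists>t' s'. tree_pair f t' s' \<and> width t' < width t"
proof -
  obtain t' X K Y where t': "length X = j" "leaf_intervals t (0, 0) = X @ [left_half K, right_half
      K] @ Y"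
      "leaf_intervals t' (0, 0) = X @ [K] @ Y"
    using tree_caret[OF assms(2,4)] by (metis diff_zero)
  obtain s' X' K' Y' where s': "length X' = j" "leaf_intervals s (0, 0) = X' @ [left_half K',
      right_half K'] @ Y'"
      "leaf_intervals s' (0, 0) = X' @ [K'] @ Y'"
    using tree_caret[OF assms(3,5)] by (metis diff_zero)
  have "list_all2 (interval_map f) (X @ [left_half K, right_half K] @ Y) (X' @ [left_half K',
      right_half K'] @ Y')"
    using assms(1) t' s' by (simp add: tree_pair_def)
  then have "list_all2 (interval_map f) X X'" "interval_map f (left_half K) (left_half K')"
    "interval_map f (right_half K) (right_half K')" "list_all2 (interval_map f) Y Y'"
    using t'(1) s'(1) by (auto simp: list_all2_append)
  then have "tree_pair f t' s'" unfolding tree_pair_def t'(3) s'(3)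
    using interval_map_merge t'(1) s'(1) by (simp add: list_all2_append)
  moreover have "width t' < width t"
    using t'(2,3)[THEN arg_cong[where f = length]] by simp
  ultimately show ?thesis by blast
qed

lemma awalk_chain:
  "pre_digraph.awalk (digraph_of D) u p v \<longleftrightarrow> u \<in> diagram_verts D \<and> set p \<subseteq> edge_set D \<and> chain u p v"
proof -
  have "pre_digraph.cas (digraph_of D) u p v = chain u p v"
    by (induction p arbitrary: u) (simp_all add: pre_digraph.cas.simps digraph_of_def)
  then show ?thesis unfolding pre_digraph.awalk_def by (simp add: digraph_of_def)
qed

lemma chain_increasing:
  "chain u p v \<Longrightarrow> \<forall>e\<in>set p. src e < tgt e \<Longrightarrow> u + length p \<le> v"
  by (induction p arbitrary: u) fastforce+

lemma chain_leaves: "i \<le> n \<Longrightarrow> chain i (map (\<lambda>j. Edge 0 j (Suc j)) [i..<n]) n"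
proof (induction "n - i" arbitrary: i)
  case (Suc d)
  then have "[i..<n] = i # [Suc i..<n]" by (simp add: upt_conv_Cons)
  then show ?case using Suc by simp
qed simp

definition pair_diagram :: "tree \<Rightarrow> tree \<Rightarrow> diagram" where
  "pair_diagram t s = diagram_mult (tree_diagram 1 t 0) (diagram_inverse (tree_diagram 2 s 0))"

text \<open>
  Going down through a diagram, the edges get shorter in the upper tree, and longer in the lower one.
  This makes \<open>above\<close> irreflexive.
\<close>

definition height :: "edge \<Rightarrow> int" where
  "height e = (if label e = 1 then int (tgt e - src e) else if label e = 2
      then - int (tgt e - src e) else 0)"

context
  fixes t s :: tree and D
  assumes ws: "width s = width t"
  defines "D \<equiv> pair_diagram t s"
begin

text \<open>
  By the choice of labels, the two trees share their leaves only.
\<close>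

lemma pair_multipliable: "multipliable (tree_diagram 1 t 0) (diagram_inverse (tree_diagram 2 s 0))"
  unfolding multipliable_def verts_inverse diagram_simps
proof (intro conjI)
  let ?P = "tree_diagram 1 t 0" and ?N = "tree_diagram 2 s 0"
  show bb: "bot_path ?P = bot_path ?N" by (simp add: tree_diagram_bot ws)
  have "path_verts (bot_path ?P) = {0..width t}"
  proof -
    have "path_verts (bot_path ?P) = {0..<width t} \<union> Suc ` {0..<width t}"
      by (simp add: path_verts_def tree_diagram_bot image_image)
    also have "\<dots> = {0..<width t} \<union> {Suc 0..<Suc (width t)}" by (simp only: image_Suc_atLeastLessThan)
    also have "\<dots> = {0..width t}" using width_pos[of t] by (auto simp del: width_pos width_ne_0)
    finally show ?thesis .
  qed
  then show "diagram_verts ?P \<inter> diagram_verts ?N = path_verts (bot_path ?P)"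
    unfolding tree_diagram_verts ws by simp
  have leaf: "e \<in> set (bot_path ?P)" if "e \<in> edge_set ?P" "e \<in> edge_set ?N" for e
  proof -
    have "label e = 0" "tgt e = Suc (src e)" "src e < width t"
      using tree_diagram_edge[OF that(1)] tree_diagram_edge[OF that(2)] by auto
    then show ?thesis unfolding tree_diagram_bot by (cases e) auto
  qed
  have "set (bot_path ?P) \<subseteq> edge_set ?P" "set (bot_path ?N) \<subseteq> edge_set ?N"
    using layeredD(3) is_diagram_layered[OF tree_diagram_is_diagram] by fastforce+
  then show "edge_set ?P \<inter> edge_set ?N = set (bot_path ?P)" using leaf bb by auto
qed

lemma pair_is_diagram: "is_diagram D"
  unfolding D_def pair_diagram_def
  by (intro is_diagram.mult is_diagram.inverse tree_diagram_is_diagram pair_multipliable)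

lemma pair_diagram_in_F: "diagram_in_F D"
  using pair_is_diagram by (simp add: diagram_in_F_def) (simp add: D_def pair_diagram_def)

lemma pair_ends: "initial_vertex D = 0" "terminal_vertex D = width t"
  by (simp_all add: D_def pair_diagram_def initial_vertex_def terminal_vertex_def)

lemma pair_verts: "diagram_verts D = {0..width t}"
proof -
  have "diagram_verts D = diagram_verts (tree_diagram 1 t 0) \<union> diagram_verts (tree_diagram 2 s 0)"
    unfolding D_def pair_diagram_def by (simp only: diagram_verts_eq diagram_simps image_Un Un_ac)
  then show ?thesis unfolding tree_diagram_verts ws by simp
qed

lemma pair_edge: "e \<in> edge_set D \<Longrightarrow> src e < tgt e \<and> tgt e \<le> width t"
  using tree_diagram_edge[of e _ t 0] tree_diagram_edge[of e _ s 0] ws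
  by (fastforce simp: D_def pair_diagram_def)

text \<open>
  Vertices are numbered from left to right, so no path has more than \<open>width t\<close> edges.
\<close>

lemma pair_longest: "longest_positive_path D (bot_path (tree_diagram 1 t 0))"
  unfolding longest_positive_path_def awalk_chain pair_ends pair_verts
proof (intro conjI allI impI)
  show "set (bot_path (tree_diagram 1 t 0)) \<subseteq> edge_set D"
    using layeredD(3) is_diagram_layered[OF tree_diagram_is_diagram, of 1 t 0]
    by (fastforce simp: D_def pair_diagram_def)
  show "chain 0 (bot_path (tree_diagram 1 t 0)) (width t)"
    unfolding tree_diagram_bot using chain_leaves[of 0 "width t"] by simp
  fix q assume q: "0 \<in> {0..width t} \<and> set q \<subseteq> edge_set D \<and> chain 0 q (width t)"
  then have "0 + length q \<le> width t" using pair_edge by (intro chain_increasing) auto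
  then show "length q \<le> length (bot_path (tree_diagram 1 t 0))" by (simp add: tree_diagram_bot)
qed simp

lemma pair_above: "(e, e') \<in> above D \<Longrightarrow> height e' < height e"
proof -
  have *: "height e' < height e" if "\<exists>(p, p')\<in>cell_set D. e \<in> set p \<and> e' \<in> set p'" for e e'
  proof -
    from that obtain p p' where pp: "(p, p') \<in> cell_set D" "e \<in> set p" "e' \<in> set p'" by auto
    have "(p, p') \<in> cell_set (tree_diagram 1 t 0) \<or> (p', p) \<in> cell_set (tree_diagram 2 s 0)"
      using pp(1) unfolding D_def pair_diagram_def by auto
    then show ?thesis
    proof
      assume c: "(p, p') \<in> cell_set (tree_diagram 1 t 0)"
      obtain f g where "p = [e]" "p' = [f, g]" "e' = f \<or> e' = g" "label e = 1"
          "tgt f - src f < tgt e - src e" "tgt g - src g < tgt e - src e"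
         "f \<in> edge_set (tree_diagram 1 t 0)" "g \<in> edge_set (tree_diagram 1 t 0)"
        using tree_diagram_cell[OF c] pp(2,3) by auto
      then show ?thesis using tree_diagram_edge[of e' 1 t 0] unfolding height_def by auto
    next
      assume c: "(p', p) \<in> cell_set (tree_diagram 2 s 0)"
      obtain f g where "p' = [e']" "p = [f, g]" "e = f \<or> e = g" "label e' = 2"
          "tgt f - src f < tgt e' - src e'" "tgt g - src g < tgt e' - src e'"
         "f \<in> edge_set (tree_diagram 2 s 0)" "g \<in> edge_set (tree_diagram 2 s 0)"
        using tree_diagram_cell[OF c] pp(2,3) by auto
      then show ?thesis using tree_diagram_edge[of e 2 s 0] unfolding height_def by auto
    qed
  qed
  assume "(e, e') \<in> above D"
  then show ?thesis unfolding above_def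
  proof (induction rule: trancl_induct)
    case (step e' e'')
    then show ?case using *[of e' e''] by simp
  qed (use * in blast)
qed

lemma pair_topmost_unique:
  assumes "topmost_incoming D v e" "topmost_incoming D v f" shows "e = f"
proof (rule ccontr)
  assume "e \<noteq> f"
  then have "(e, f) \<in> above D" "(f, e) \<in> above D"
    using assms by (auto simp: topmost_incoming_def)
  then show False using pair_above[of e f] pair_above[of f e] by simp
qed

lemma pair_bottommost_unique:
  assumes "bottommost_incoming D v e" "bottommost_incoming D v f" shows "e = f"
proof (rule ccontr)
  assume "e \<noteq> f"
  then have "(e, f) \<in> above D" "(f, e) \<in> above D"
    using assms by (auto simp: bottommost_incoming_def)
  then show False using pair_above[of e f] pair_above[of f e] by simp
qed

text \<open>
  If corresponding end points of the two subdivisions have equal parity, then this parity is a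
  colouring for both the upper and the lower edges.
\<close>

lemma pair_bipartite:
  assumes c1: "\<And>v. v < width t \<Longrightarrow> thue_morse (snd (leaf_intervals s (0, 0) ! v)) = thue_morse (snd
      (leaf_intervals t (0, 0) ! v))"
  shows "bipartite (thompson_graph D)"
proof -
  define c where "c v = thue_morse (snd (leaf_intervals t (0, 0) ! v))" for v
  define U where "U = {v. v < width t \<and> c v}"
  define W where "W = {v. v < width t \<and> \<not> c v}"
  have inner: "0 < v" "v < width t" if "v \<in> inner_verts D" for v
    using that by (auto simp: inner_verts_def pair_verts pair_ends)
  have UW: "src e \<in> U \<and> tgt e \<in> W \<or> src e \<in> W \<and> tgt e \<in> U"
    if "c (src e) \<noteq> c (tgt e)" "src e < width t" "tgt e < width t" for e
    using that by (auto simp: U_def W_def)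
  have top: "src e \<in> U \<and> tgt e \<in> W \<or> src e \<in> W \<and> tgt e \<in> U"
    if v: "v \<in> inner_verts D" and e: "topmost_incoming D v e" for v e
  proof -
    \<comment> \<open>every inner vertex is the middle of a cell of the upper tree\<close>
    obtain e0 f g where cell: "([e0], [f, g]) \<in> cell_set (tree_diagram 1 t 0)" and f: "tgt f = v"
      using tree_diagram_mid[of 0 v t 1] inner[OF v] by auto
    have "([e0], [f, g]) \<in> cell_set D" using cell by (simp add: D_def pair_diagram_def)
    from topmost_of_pi_cell(1)[OF pair_is_diagram this] have "e = f"
      using pair_topmost_unique e f by blast
    then show ?thesis using tree_diagram_parity[OF cell, of "(0, 0)"] by (intro UW) (auto simp: c_def)
  qed
  have bot: "src e \<in> U \<and> tgt e \<in> W \<or> src e \<in> W \<and> tgt e \<in> U"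
    if v: "v \<in> inner_verts D" and e: "bottommost_incoming D v e" for v e
  proof -
    obtain e0 f g where cell: "([e0], [f, g]) \<in> cell_set (tree_diagram 2 s 0)" and f: "tgt f = v"
      using tree_diagram_mid[of 0 v s 2] inner[OF v] ws by auto
    have "([f, g], [e0]) \<in> cell_set D" using cell by (force simp: D_def pair_diagram_def)
    from bottommost_of_pi_inverse_cell(1)[OF pair_is_diagram this] have "e = f"
      using pair_bottommost_unique e f by blast
    then show ?thesis using tree_diagram_parity[OF cell, of "(0, 0)"] c1[of "src f"] c1[of "tgt f"] ws
      by (intro UW) (auto simp: c_def)
  qed
  have "verts (thompson_graph D) = {0..width t} - {width t}"
    unfolding thompson_graph_def pair_verts pair_ends by simp
  also have "\<dots> = U \<union> W" by (auto simp: U_def W_def)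
  finally have V: "verts (thompson_graph D) = U \<union> W" .
  have A: "tail (thompson_graph D) e \<in> U \<and> head (thompson_graph D) e \<in> W \<or>
     tail (thompson_graph D) e \<in> W \<and> head (thompson_graph D) e \<in> U"
         if e: "e \<in> arcs (thompson_graph D)" for e
  proof -
    consider x v where "e = Inl x" "v \<in> inner_verts D" "topmost_incoming D v x"
      | x v where "e = Inr x" "v \<in> inner_verts D" "bottommost_incoming D v x"
      using e unfolding thompson_graph_def by auto
    then show ?thesis
    proof cases
      case 1
      then show ?thesis using top[OF 1(2,3)] by (simp add: thompson_graph_def)
    next
      case 2
      then show ?thesis using bot[OF 2(2,3)] by (simp add: thompson_graph_def)
    qed
  qed
  have "U \<inter> W = {}" by (auto simp: U_def W_def)
  then show ?thesis unfolding bipartite_def using V A by blast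
qed

lemma pair_represents:
  assumes "tree_pair f t s"
  shows "represents D f"
  unfolding represents_def
proof (intro exI conjI)
  let ?P = "tree_diagram 1 t 0" and ?N = "diagram_inverse (tree_diagram 2 s 0)"
  show "is_diagram ?P" "is_diagram ?N" by (intro tree_diagram_is_diagram is_diagram.inverse)+
  show "multipliable ?P ?N" by (rule pair_multipliable)
  show "D = diagram_mult ?P ?N" by (simp add: D_def pair_diagram_def)
  show "longest_positive_path D (bot_path ?P)" by (rule pair_longest)
  show "\<forall>c\<in>cell_set ?P. is_pi_cell c"
    using tree_diagram_cell[of _ _ 1 t 0] by (force simp: is_pi_cell_def)
  show "\<forall>c\<in>cell_set ?N. is_pi_inverse_cell c"
    using tree_diagram_cell[of _ _ 2 s 0] by (force simp: is_pi_inverse_cell_def)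
  have unit: "left_end (0, 0) = 0" "right_end (0, 0) = 1" by (simp_all add: left_end_def right_end_def)
  show "\<forall>e\<in>set (bot_path ?P). \<exists>a b c d.
        assigned ?P e a b \<and> assigned (diagram_inverse ?N) e c d \<and> maps_linearly f a b c d"
  proof
    fix e assume "e \<in> set (bot_path ?P)"
    then obtain j where j: "j < width t" "e = Edge 0 (0 + j) (Suc (0 + j))"
        by (auto simp: tree_diagram_bot)
    let ?I = "leaf_intervals t (0, 0) ! j" and ?J = "leaf_intervals s (0, 0) ! j"
    have "assigned ?P e (left_end ?I) (right_end ?I)" unfolding j(2)
      by (rule tree_diagram_assigned[where q = 1]) (auto simp: unit j intro: assigned.top)
    moreover have "assigned (diagram_inverse ?N) e (left_end ?J) (right_end ?J)"
        unfolding j(2) inverse_inverse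
      by (rule tree_diagram_assigned[where q = 2]) (auto simp: unit j ws intro: assigned.top)
    moreover have "interval_map f ?I ?J" using assms j(1)
        by (simp add: tree_pair_def list_all2_conv_all_nth)
    ultimately show "\<exists>a b c d.
        assigned ?P e a b \<and> assigned (diagram_inverse ?N) e c d \<and> maps_linearly f a b c d"
      unfolding interval_map_iff_maps_linearly by blast
  qed
qed

text \<open>
  A dipole \<open>\<pi> \<circ> \<pi>\<^sup>-\<^sup>1\<close> sits at two neighbouring leaves that have a common parent in both trees.
  Cutting them off in both trees would leave a smaller pair. The other kind of dipole is excluded by
  the labels, since cells \<open>\<pi>\<close> occur in the upper tree only.
\<close>

lemma pair_reduced:
  assumes "tree_pair f t s" and min: "\<And>t' s'. tree_pair f t' s' \<Longrightarrow> width t \<le> width t'"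
  shows "reduced D"
  unfolding reduced_def
proof
  assume "\<exists>c\<in>cell_set D. \<exists>d\<in>cell_set D. is_dipole c d"
  then obtain p1 p2 p3 where cd: "(p1, p2) \<in> cell_set D" "(p2, p3) \<in> cell_set D"
    and k: "is_pi_cell (p1, p2) \<and> is_pi_inverse_cell (p2, p3) \<or> is_pi_inverse_cell (p1, p2) \<and>
        is_pi_cell (p2, p3)"
    unfolding is_dipole_def by fastforce
  have P: "(p, p') \<in> cell_set (tree_diagram 1 t 0)" if "(p, p') \<in> cell_set D" "is_pi_cell (p, p')"
      for p p'
    using that tree_diagram_cell[of p' p 2 s 0] by (auto simp: D_def pair_diagram_def is_pi_cell_def)
  have N: "(p', p) \<in> cell_set (tree_diagram 2 s 0)"
      if "(p, p') \<in> cell_set D" "is_pi_inverse_cell (p, p')" for p p'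
    using that tree_diagram_cell[of p p' 1 t 0]
        by (auto simp: D_def pair_diagram_def is_pi_inverse_cell_def)
  from k show False
  proof (elim disjE conjE)
    assume "is_pi_cell (p1, p2)" "is_pi_inverse_cell (p2, p3)"
    then have c: "(p1, p2) \<in> cell_set (tree_diagram 1 t 0)" "(p3, p2) \<in> cell_set (tree_diagram 2 s 0)"
      using P N cd by blast+
    obtain e f g where efg: "p1 = [e]" "p2 = [f, g]" "f \<in> edge_set (tree_diagram 1 t 0)" "g \<in>
        edge_set (tree_diagram 1 t 0)"
      using tree_diagram_cell[OF c(1)] by blast
    obtain e' where e': "p3 = [e']" "f \<in> edge_set (tree_diagram 2 s 0)" "g \<in> edge_set (tree_diagram
        2 s 0)"
      using tree_diagram_cell[OF c(2)] efg(2) by auto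
    have "label f = 0" "label g = 0" "tgt f = Suc (src f)" "tgt g = Suc (src g)"
      using tree_diagram_edge[OF efg(3)] tree_diagram_edge[OF efg(4)]
        tree_diagram_edge[OF e'(2)] tree_diagram_edge[OF e'(3)] by auto
    moreover have "tgt f = src g"
      using pi_cell_triple[of "tree_diagram 1 t 0" e f g] c(1) efg is_diagram_layered[OF
          tree_diagram_is_diagram]
      by (auto simp: pi_triple_def)
    ultimately have "p2 = [Edge 0 (src f) (Suc (src f)), Edge 0 (Suc (src f)) (Suc (Suc (src f)))]"
      using efg(2) by (cases f; cases g) auto
    then have "\<exists>t' s'. tree_pair f' t' s' \<and> width t' < width t" if "tree_pair f' t s" for f'
      using tree_pair_reduce[OF that, of 1 2 e "src f" e'] c efg(1) e'(1) by simp
    then show False using assms(1) min by (meson not_le)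
  next
    assume "is_pi_inverse_cell (p1, p2)" "is_pi_cell (p2, p3)"
    then have c: "(p2, p1) \<in> cell_set (tree_diagram 2 s 0)" "(p2, p3) \<in> cell_set (tree_diagram 1 t 0)"
      using P N cd by blast+
    show False using tree_diagram_cell[OF c(1)] tree_diagram_cell[OF c(2)] by auto
  qed
qed

end

lemma jones_if_preserves_parity:
  assumes f: "thompson_map f" and par: "preserves_parity f"
  shows "f \<in> jones_subgroup"
proof -
  \<comment> \<open>a pair of trees with as few leaves as possible\<close>
  have "\<exists>n t s. tree_pair f t s \<and> width t = n" using tree_pair_exists[OF f] by blast
  from exists_least_iff[THEN iffD1, OF this]
  obtain t s where ts: "tree_pair f t s" and min: "\<And>t' s'. tree_pair f t' s' \<Longrightarrow> width t \<le> width t'"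
    by (metis not_less)
  have ws: "width s = width t" using ts[unfolded tree_pair_def, THEN list_all2_lengthD] by simp
  have "thue_morse (snd (leaf_intervals s (0, 0) ! v)) = thue_morse (snd (leaf_intervals t (0, 0) !
      v))" if v: "v < width t" for v
  proof -
    let ?I = "leaf_intervals t (0, 0) ! v" and ?J = "leaf_intervals s (0, 0) ! v"
    have "interval_map f ?I ?J" using ts v by (simp add: tree_pair_def list_all2_conv_all_nth)
    then have "f (left_end ?I) = left_end ?J" using interval_map_ends by blast
    moreover have "?I \<in> set (leaf_intervals t (0, 0))" "?J \<in> set (leaf_intervals s (0, 0))"
        using v ws by simp_all
    then have u: "snd ?I < 2 ^ fst ?I" "snd ?J < 2 ^ fst ?J" by (auto dest: leaf_intervals_unit)
    moreover have "left_end ?I \<in> {0..1}"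
    proof -
      have "real (snd ?I) \<le> real (2 ^ fst ?I)" using u(1) by (simp only: of_nat_le_iff less_imp_le)
      then show ?thesis by (simp add: left_end_def)
    qed
    ultimately show ?thesis using par odd_dyadics_iff
        unfolding preserves_parity_def left_end_def by metis
  qed
  then have "bipartite (thompson_graph (pair_diagram t s))" using pair_bipartite[OF ws] by blast
  then show ?thesis using f pair_diagram_in_F[OF ws] pair_reduced[OF ws ts min] pair_represents[OF ws ts]
    unfolding jones_subgroup_def by auto
qed

section \<open>The subgroup as a stabilizer\<close>

lemma jones_iff: "f \<in> jones_subgroup \<longleftrightarrow> thompson_map f \<and> preserves_parity f"
  using jones_preserves_parity jones_if_preserves_parity by (auto simp: jones_subgroup_def)

interpretation TF: group thompson_F
  by (rule group_F)

lemma (in group) subgroup_nat_pow_closed: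
  assumes "subgroup H G" "h \<in> H"
  shows "h [^] (n::nat) \<in> H"
  by (induction n) (auto simp: subgroup.one_closed[OF assms(1)] subgroup.m_closed[OF assms(1)] assms(2))

lemma (in group) intertwine_nat_pow:
  assumes "a \<in> carrier G" "b \<in> carrier G" "g \<in> carrier G" "a \<otimes> g = g \<otimes> b"
  shows "a [^] (n::nat) \<otimes> g = g \<otimes> b [^] n"
proof (induction n)
  case (Suc n)
  have "a [^] Suc n \<otimes> g = a [^] n \<otimes> (a \<otimes> g)" using assms(1-3) by (simp add: m_assoc)
  also have "\<dots> = (a [^] n \<otimes> g) \<otimes> b" using assms by (simp add: m_assoc)
  also have "\<dots> = g \<otimes> b [^] Suc n" using assms(1-3) by (simp add: Suc m_assoc)
  finally show ?case .
qed (use assms in simp)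

lemma inv_F_apply:
  assumes "thompson_map f" "x \<in> {0..1}"
  shows "f ((inv\<^bsub>thompson_F\<^esub> f) x) = x"
proof -
  have "inv\<^bsub>thompson_F\<^esub> f \<otimes>\<^bsub>thompson_F\<^esub> f = \<one>\<^bsub>thompson_F\<^esub>" by (rule TF.l_inv) (simp add: assms)
  from fun_cong[OF this, of x] show ?thesis using assms(2) by (simp add: compose_def)
qed

lemma inv_F_map: "thompson_map f \<Longrightarrow> thompson_map (inv\<^bsub>thompson_F\<^esub> f)"
  using TF.inv_closed[of f] by simp

lemma jones_subgroup_is_subgroup: "subgroup jones_subgroup thompson_F"
proof (rule TF.subgroupI)
  show "jones_subgroup \<subseteq> carrier thompson_F" by (auto simp: jones_iff)
  have "(\<lambda>x\<in>{0..1}. x) \<in> jones_subgroup" by (simp add: jones_iff thompson_id preserves_parity_def)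
  then show "jones_subgroup \<noteq> {}" by blast
next
  fix f assume f: "f \<in> jones_subgroup"
  then have fm: "thompson_map f" by (simp add: jones_iff)
  have "(inv\<^bsub>thompson_F\<^esub> f) x \<in> odd_dyadics \<longleftrightarrow> x \<in> odd_dyadics" if "x \<in> {0..1}" for x
    using thompson_range[OF inv_F_map[OF fm] that] inv_F_apply[OF fm that] f
    unfolding jones_iff preserves_parity_def by metis
  then show "inv\<^bsub>thompson_F\<^esub> f \<in> jones_subgroup"
    using inv_F_map[OF fm] by (simp add: jones_iff preserves_parity_def)
next
  fix f g assume "f \<in> jones_subgroup" "g \<in> jones_subgroup"
  then show "f \<otimes>\<^bsub>thompson_F\<^esub> g \<in> jones_subgroup"
    using thompson_range[of f] thompson_compose[of f g]
        by (auto simp: jones_iff preserves_parity_def compose_eq)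
qed

section \<open>A contraction towards 0\<close>

text \<open>
  This map is linear on \<open>[0, 1/2]\<close>, \<open>[1/2, 3/4]\<close>, \<open>[3/4, 7/8]\<close> and \<open>[7/8, 1]\<close>, which it sends to
  \<open>[0, 1/4]\<close>, \<open>[1/4, 3/8]\<close>, \<open>[3/8, 1/2]\<close> and \<open>[1/2, 1]\<close>. Corresponding left ends have digit sums
  of equal parity: \<open>0\<close> and \<open>0\<close>, \<open>1\<close> and \<open>1\<close>, \<open>2\<close> and \<open>2\<close>, \<open>3\<close> and \<open>1\<close>. Being convex,
  it is the maximum of its linear pieces.
\<close>

definition shrink :: "real \<Rightarrow> real" where
  "shrink x = max (x / 2) (max (x - 3 / 8) (4 * x - 3))"

lemma shrink_less: "0 < x \<Longrightarrow> x < 1 \<Longrightarrow> shrink x < x"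
  by (simp add: shrink_def)

lemma shrink_range: "0 \<le> x \<Longrightarrow> x \<le> 1 \<Longrightarrow> 0 \<le> shrink x \<and> shrink x \<le> x"
  by (auto simp: shrink_def)

lemma thompson_shrink: "thompson_map (restrict shrink {0..1})"
proof (rule thompson_mapI[where B = "{3 / 4, 7 / 8}"
    and g = "\<lambda>y. min (2 * y) (min (y + 3 / 8) ((y + 3) / 4))"])
  show "homeomorphism {0..1} {0..1} (restrict shrink {0..1}) (\<lambda>y. min (2 * y) (min (y + 3 / 8) ((y +
      3) / 4)))"
  proof (rule homeomorphism_cong)
    show "homeomorphism {0..1} {0..1} shrink (\<lambda>y. min (2 * y) (min (y + 3 / 8) ((y + 3) / 4)))"
    proof (rule homeomorphismI)
      show "continuous_on {0..1} shrink" unfolding shrink_def by (intro continuous_intros) auto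
      show "continuous_on {0..1} (\<lambda>y::real. min (2 * y) (min (y + 3 / 8) ((y + 3) / 4)))"
        by (intro continuous_intros) auto
    qed (auto simp: shrink_def min_def max_def field_simps)
  qed auto
  show "strict_mono_on {0..1} (restrict shrink {0..1})"
    by (rule strict_mono_onI) (auto simp: shrink_def max_def)
  have "3 / 2 ^ 2 \<in> dyadic_fractions" "7 / 2 ^ 3 \<in> dyadic_fractions"
    using dyadic_div[OF dyadic_nat[of 3], of 2] dyadic_div[OF dyadic_nat[of 7], of 3] by simp_all
  then show "{3 / 4, 7 / 8} \<subseteq> dyadic_fractions" by simp
  fix a b :: real assume ab: "0 \<le> a" "a < b" "b \<le> 1" "{a<..<b} \<inter> {3 / 4, 7 / 8} = {}"
  then consider "b \<le> 3 / 4" | "3 / 4 \<le> a" "b \<le> 7 / 8" | "7 / 8 \<le> a" by force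
  then show "\<exists>k c. \<forall>x\<in>{a..b}. restrict shrink {0..1} x = 2 powi k * x + c"
  proof cases
    case 1
    then show ?thesis using ab by (intro exI[of _ "-1"] exI[of _ 0]) (auto simp: shrink_def max_def
        power_int_minus)
  next
    case 2
    then show ?thesis using ab by (intro exI[of _ 0] exI[of _ "- 3 / 8"]) (auto simp: shrink_def max_def)
  next
    case 3
    then show ?thesis using ab by (intro exI[of _ 2] exI[of _ "- 3"]) (auto simp: shrink_def max_def)
  qed
qed auto

lemma shrink_jones: "restrict shrink {0..1} \<in> jones_subgroup"
proof -
  let ?h = "restrict shrink {0..1}"
  have 1: "interval_map ?h (1, 0) (2, 0)" "interval_map ?h (2, 2) (3, 2)" "interval_map ?h (3, 6)
      (3, 3)" "interval_map ?h (3, 7) (1, 1)"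
    by (auto simp: interval_map_def shrink_def max_def field_simps)
  have t: "thue_morse 2 = thue_morse 2" "thue_morse 6 = thue_morse 3" "thue_morse 7 = thue_morse 1"
      by (simp_all add: thue_morse.simps)
  have "preserves_parity ?h"
  proof (rule preserves_parityI[OF thompson_shrink])
    fix x :: real assume x: "0 \<le> x" "x < 1"
    consider "x < 1 / 2" | "1 / 2 \<le> x" "x < 3 / 4" | "3 / 4 \<le> x" "x < 7 / 8" | "7 / 8 \<le> x" by linarith
    then show "\<exists>k m l m'. interval_map ?h (k, m) (l, m') \<and> m < 2 ^ k \<and> m' < 2 ^ l \<and>
        thue_morse m = thue_morse m'
       \<and> left_end (k, m) \<le> x \<and> x < right_end (k, m)"
    proof cases
      case 1
      then show ?thesis using \<open>interval_map ?h (1, 0) (2, 0)\<close> x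
        by (intro exI[of _ 1] exI[of _ 0] exI[of _ 2]) (auto simp: left_end_def right_end_def)
    next
      case 2
      then show ?thesis using \<open>interval_map ?h (2, 2) (3, 2)\<close>
        by (intro exI[of _ 2] exI[of _ 3]) (auto simp: left_end_def right_end_def)
    next
      case 3
      then show ?thesis using \<open>interval_map ?h (3, 6) (3, 3)\<close> t
        by (intro exI[of _ 3] exI[of _ 6]) (auto simp: left_end_def right_end_def intro!: exI[of _ 3])
    next
      case 4
      then show ?thesis using \<open>interval_map ?h (3, 7) (1, 1)\<close> t x
        by (intro exI[of _ 3] exI[of _ 7] exI[of _ 1]) (auto simp: left_end_def right_end_def)
    qed
  qed
  then show ?thesis by (simp add: jones_iff thompson_shrink)
qed

lemma shrink_iterate:
  assumes "0 \<le> x" "x \<le> 1"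
  shows "0 \<le> (shrink ^^ n) x \<and> (shrink ^^ n) x \<le> x"
proof (induction n)
  case (Suc n)
  then show ?case using shrink_range[of "(shrink ^^ n) x"] assms by simp
qed (use assms in simp)

text \<open>
  The iterates decrease to a fixed point of \<open>shrink\<close> below \<open>1\<close>, and \<open>0\<close> is the only one.
\<close>

lemma shrink_tendsto_zero:
  assumes "0 \<le> x" "x < 1"
  shows "(\<lambda>n. (shrink ^^ n) x) \<longlonglongrightarrow> 0"
proof -
  have b: "0 \<le> (shrink ^^ n) x \<and> (shrink ^^ n) x \<le> x" for n using shrink_iterate assms by simp
  have "decseq (\<lambda>n. (shrink ^^ n) x)"
  proof (rule decseq_SucI)
    show "(shrink ^^ Suc n) x \<le> (shrink ^^ n) x" for n
      using shrink_range[of "(shrink ^^ n) x"] b[of n] assms by simp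
  qed
  moreover have "\<forall>n. 0 \<le> (shrink ^^ n) x" using b by blast
  ultimately obtain L where L: "(\<lambda>n. (shrink ^^ n) x) \<longlonglongrightarrow> L" by (rule decseq_convergent)
  have "(\<lambda>n. shrink ((shrink ^^ n) x)) \<longlonglongrightarrow> shrink L"
  proof (rule isCont_tendsto_compose[OF _ L])
    show "isCont shrink L" unfolding shrink_def by (intro continuous_intros) auto
  qed
  moreover have "(\<lambda>n. shrink ((shrink ^^ n) x)) \<longlonglongrightarrow> L"
    using LIMSEQ_Suc[OF L] by simp
  ultimately have "shrink L = L" by (rule LIMSEQ_unique)
  moreover have "0 \<le> L" by (rule LIMSEQ_le_const[OF L]) (use b in blast)
  moreover have "L \<le> x" by (rule LIMSEQ_le_const2[OF L]) (use b in blast)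
  ultimately have "L = 0" using shrink_less[of L] assms by force
  then show ?thesis using L by simp
qed

text \<open>
  Near \<open>0\<close>, the map \<open>g\<close> is multiplication by a power of 2, which shifts digits.
\<close>

lemma thompson_parity_near_zero:
  assumes "thompson_map g"
  shows "\<exists>N. \<forall>x. 0 \<le> x \<and> x < 1 / 2 ^ N \<longrightarrow> (g x \<in> odd_dyadics \<longleftrightarrow> x \<in> odd_dyadics)"
proof -
  obtain N where "\<forall>i<2 ^ N. \<exists>J. interval_map g (N, i) J" using thompson_grid[OF assms] by blast
  then obtain l m where lm: "interval_map g (N, 0) (l, m)"
      by (metis prod.collapse zero_less_numeral zero_less_power)
  from interval_map_ends[OF lm] have "m = 0" using thompson_mapD(4)[OF assms] by (simp add: left_end_def)
  have "g x \<in> odd_dyadics \<longleftrightarrow> x \<in> odd_dyadics" if "0 \<le> x" "x < 1 / 2 ^ N" for x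
    using interval_map_parity[of g N 0 l 0 "x * 2 ^ N"] lm that \<open>m = 0\<close> by (simp add: field_simps)
  then show ?thesis by blast
qed

section \<open>Commensurating elements\<close>

lemma pow_F_apply: "x \<in> {0..1} \<Longrightarrow> (restrict shrink {0..1} [^]\<^bsub>thompson_F\<^esub> (n::nat)) x = (shrink ^^ n) x"
proof (induction n)
  case (Suc n)
  then show ?case using shrink_iterate[of x n] by (simp add: compose_def)
qed simp

text \<open>
  Some power of \<open>shrink\<close> is conjugate under \<open>g\<close> to an element of the subgroup. It moves every point
  to where \<open>g\<close> is known to preserve parity.
\<close>

lemma commensurating_preserves_parity:
  assumes "g \<in> commensurator thompson_F jones_subgroup"
  shows "g \<in> jones_subgroup"
proof -
  let ?F = "thompson_F" and ?H = "jones_subgroup" and ?h = "restrict shrink {0..1}"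
  let ?K = "(g <#\<^bsub>?F\<^esub> ?H) #>\<^bsub>?F\<^esub> (inv\<^bsub>?F\<^esub> g)"
  have g: "thompson_map g" and fin: "finite (rcosets\<^bsub>?F\<lparr>carrier := ?H\<rparr>\<^esub> (?H \<inter> ?K))"
    using assms by (auto simp: commensurator_def Let_def)
  have gF: "g \<in> carrier ?F" using g by simp
  have hF: "?h \<in> carrier ?F" using thompson_shrink by simp
  note sub = jones_subgroup_is_subgroup
  have K: "k \<in> ?K \<longleftrightarrow> (\<exists>h'\<in>?H. k = g \<otimes>\<^bsub>?F\<^esub> h' \<otimes>\<^bsub>?F\<^esub> inv\<^bsub>?F\<^esub> g)" for k
    by (auto simp: l_coset_def r_coset_def simp del: thompson_F_simps)
  have HF: "x \<in> ?H \<Longrightarrow> x \<in> carrier ?F" for x using subgroup.mem_carrier[OF sub] .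
  have powH: "?h [^]\<^bsub>?F\<^esub> (n::nat) \<in> ?H" for n
    by (rule TF.subgroup_nat_pow_closed[OF sub shrink_jones])
  have one: "\<one>\<^bsub>?F\<^esub> \<in> ?H \<inter> ?K"
    using K subgroup.one_closed[OF sub] TF.r_inv[OF gF] gF TF.r_one by (metis IntI)
  \<comment> \<open>finitely many cosets, so two powers of the contraction lie in the same one\<close>
  define C where "C n = (?H \<inter> ?K) #>\<^bsub>?F\<^esub> (?h [^]\<^bsub>?F\<^esub> (n::nat))" for n
  have "range C \<subseteq> rcosets\<^bsub>?F\<lparr>carrier := ?H\<rparr>\<^esub> (?H \<inter> ?K)"
    using powH by (auto simp: RCOSETS_def C_def r_coset_def simp del: thompson_F_simps)
  then have "finite (range C)" using fin by (rule finite_subset)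
  then have "\<not> inj C" using finite_imageD infinite_UNIV_nat by blast
  then obtain i j where ij: "i < j" "C i = C j" by (metis injI linorder_neqE_nat)
  have rc: "z \<in> A #>\<^bsub>?F\<^esub> y \<longleftrightarrow> (\<exists>a\<in>A. z = a \<otimes>\<^bsub>?F\<^esub> y)" for z y A
    by (auto simp: r_coset_def simp del: thompson_F_simps)
  have "?h [^]\<^bsub>?F\<^esub> j \<in> C j"
    unfolding C_def rc[of _ "?H \<inter> ?K"] using one TF.l_one[OF TF.nat_pow_closed[OF hF], of j] by metis
  then obtain k where k: "k \<in> ?H" "k \<in> ?K" "?h [^]\<^bsub>?F\<^esub> j = k \<otimes>\<^bsub>?F\<^esub> ?h [^]\<^bsub>?F\<^esub> i"
    unfolding ij(2)[symmetric] unfolding C_def rc[of _ "?H \<inter> ?K"] by blast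
  define r where "r = j - i"
  have r: "0 < r" "r + i = j" using ij(1) by (auto simp: r_def)
  have "?h [^]\<^bsub>?F\<^esub> r \<otimes>\<^bsub>?F\<^esub> ?h [^]\<^bsub>?F\<^esub> i = k \<otimes>\<^bsub>?F\<^esub> ?h [^]\<^bsub>?F\<^esub> i"
    using TF.nat_pow_mult[OF hF, of r i] r(2) k(3) by (simp del: thompson_F_simps)
  then have "?h [^]\<^bsub>?F\<^esub> r = k" using TF.right_cancel TF.nat_pow_closed[OF hF] HF[OF k(1)] by blast
  then obtain h' where h': "h' \<in> ?H" "?h [^]\<^bsub>?F\<^esub> r = g \<otimes>\<^bsub>?F\<^esub> h' \<otimes>\<^bsub>?F\<^esub> inv\<^bsub>?F\<^esub> g"
    using k(2) K by blast
  have conj: "?h [^]\<^bsub>?F\<^esub> (r * n) \<otimes>\<^bsub>?F\<^esub> g = g \<otimes>\<^bsub>?F\<^esub> h' [^]\<^bsub>?F\<^esub> n" for n :: nat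
  proof -
    have "?h [^]\<^bsub>?F\<^esub> r \<otimes>\<^bsub>?F\<^esub> g = g \<otimes>\<^bsub>?F\<^esub> h'"
      unfolding h'(2) using gF HF[OF h'(1)] by (simp add: TF.m_assoc del: thompson_F_simps)
    from TF.intertwine_nat_pow[OF TF.nat_pow_closed[OF hF] HF[OF h'(1)] gF this]
    show ?thesis unfolding TF.nat_pow_pow[OF hF] .
  qed
  obtain N where N: "\<forall>x. 0 \<le> x \<and> x < 1 / 2 ^ N \<longrightarrow> (g x \<in> odd_dyadics \<longleftrightarrow> x \<in> odd_dyadics)"
    using thompson_parity_near_zero[OF g] by blast
  have "g x \<in> odd_dyadics \<longleftrightarrow> x \<in> odd_dyadics" if x: "0 \<le> x" "x < 1" for x
  proof -
    have "\<forall>\<^sub>F n in sequentially. (shrink ^^ n) x < 1 / 2 ^ N"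
      using shrink_tendsto_zero[OF x] by (rule order_tendstoD) simp
    then obtain n0 where "\<forall>n\<ge>n0. (shrink ^^ n) x < 1 / 2 ^ N" unfolding eventually_sequentially by blast
    moreover have "r * n0 \<ge> n0" using r(1) by simp
    ultimately have small: "(shrink ^^ (r * n0)) x < 1 / 2 ^ N" by blast
    have x01: "x \<in> {0..1}" using x by simp
    let ?y = "(shrink ^^ (r * n0)) x"
    have y: "0 \<le> ?y" using shrink_iterate x by simp
    have "?h [^]\<^bsub>?F\<^esub> (r * n0) \<in> ?H" by (rule powH)
    then have "x \<in> odd_dyadics \<longleftrightarrow> ?y \<in> odd_dyadics"
      using x01 pow_F_apply[OF x01, of "r * n0"] unfolding jones_iff preserves_parity_def by metis
    also have "\<dots> \<longleftrightarrow> g ?y \<in> odd_dyadics" using N small y by blast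
    also have "g ?y = (h' [^]\<^bsub>?F\<^esub> n0) (g x)"
      using fun_cong[OF conj[of n0], of x] x01 pow_F_apply[OF x01] by (simp add: compose_def)
    also have "\<dots> \<in> odd_dyadics \<longleftrightarrow> g x \<in> odd_dyadics"
    proof -
      have "h' [^]\<^bsub>?F\<^esub> n0 \<in> ?H" by (rule TF.subgroup_nat_pow_closed[OF sub h'(1)])
      then show ?thesis using thompson_range[OF g x01] by (auto simp: jones_iff preserves_parity_def)
    qed
    finally show ?thesis by simp
  qed
  moreover have "g 1 = 1" using thompson_mapD(5)[OF g] .
  ultimately have "preserves_parity g"
    unfolding preserves_parity_def by (metis atLeastAtMost_iff order_le_less)
  then show ?thesis using g by (simp add: jones_iff)
qed

lemma (in group) subgroup_le_commensurator:
  assumes H: "subgroup H G"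
  shows "H \<subseteq> commensurator G H"
proof
  fix g assume g: "g \<in> H"
  then have gG: "g \<in> carrier G" using subgroup.mem_carrier[OF H] by blast
  have K: "(g <# H) #> inv g = H"
    using coset_join3[OF gG H g] coset_join2[OF inv_closed[OF gG] H] subgroup.m_inv_closed[OF H g]
        by simp
  have "rcosets\<^bsub>G\<lparr>carrier := H\<rparr>\<^esub> H \<subseteq> {H}"
    using coset_join2[OF _ H] subgroup.mem_carrier[OF H] by (auto simp: RCOSETS_def r_coset_def)
  then have "finite (rcosets\<^bsub>G\<lparr>carrier := H\<rparr>\<^esub> H)" by (rule finite_subset) simp
  then show "g \<in> commensurator G H" using gG by (simp add: commensurator_def K)
qed

theorem corollary3:
  shows "commensurator thompson_F jones_subgroup = jones_subgroup"
  using commensurating_preserves_parity TF.subgroup_le_commensurator[OF jones_subgroup_is_subgroup]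
      by blast

end
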